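(* Let $\mathcal C$ and $\mathcal D$ be monoidal categories with left dualities, and let $F\dashv U$ be an adjunction with $F\colon\mathcal C\to\mathcal D$ and $U\colon\mathcal D\to\mathcal C$, where $U$ is strong monoidal, with unit $\eta\colon\mathrm{Id}_{\mathcal C}\Rightarrow U\circ F$ and counit $\epsilon\colon F\circ U\Rightarrow\mathrm{Id}_{\mathcal D}$. Let $T=U\circ F$ with its bimonad structure described in the context, and let $\varphi_d\colon{}^\vee U(d)\to U({}^\vee d)$ be the canonical natural isomorphism described in the context. Then the natural transformation $\mathsf S\colon T\circ{}^\vee\circ T^{\mathrm{op}}\Rightarrow{}^\vee$ with components $$\mathsf S_x:={}^\vee\eta_x\circ\varphi_{F(x)}^{-1}\circ U(\epsilon_{{}^\vee F(x)})\circ UF(\varphi_{F(x)})\colon UF({}^\vee UF(x))\to{}^\vee x$$ is a left antipode for the bimonad $U\circ F$.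
   Context: A left duality on a monoidal category consists of a functor ${}^\vee$ from its opposite category to itself and morphisms $\mathsf{ev}_a\colon{}^\vee a\otimes a\to\mathbf 1$, $\mathsf{coev}_a\colon\mathbf 1\to a\otimes{}^\vee a$ for every object $a$ that are dinatural, i.e. for every $f\colon a\to a'$: $\mathsf{ev}_a\circ({}^\vee f\otimes\mathrm{id}_a)=\mathsf{ev}_{a'}\circ(\mathrm{id}_{{}^\vee a'}\otimes f)$ and $(f\otimes\mathrm{id})\circ\mathsf{coev}_a=(\mathrm{id}\otimes{}^\vee f)\circ\mathsf{coev}_{a'}$, and that satisfy the snake relations (associativity and unit isomorphisms suppressed) $(\mathrm{id}_a\otimes\mathsf{ev}_a)\circ(\mathsf{coev}_a\otimes\mathrm{id}_a)=\mathrm{id}_a$ and $(\mathsf{ev}_a\otimes\mathrm{id}_{{}^\vee a})\circ(\mathrm{id}_{{}^\vee a}\otimes\mathsf{coev}_a)=\mathrm{id}_{{}^\vee a}$. A bimonad on a monoidal category is a monad $(T,\mu,\iota)$ with an opmonoidal structure, i.e. natural morphisms $(\sigma_2)_{x,y}\colon T(x\otimes y)\to T(x)\otimes T(y)$ and a morphism $\sigma_0\colon T(\mathbf 1)\to\mathbf 1$ satisfying the usual coassociativity and counit coherence conditions, such that $\mu$ and $\iota$ are opmonoidal natural transformations: $(\sigma_2)_{x,y}\circ\mu_{x\otimes y}=(\mu_x\otimes\mu_y)\circ(\sigma_2)_{T(x),T(y)}\circ T((\sigma_2)_{x,y})$; $(\sigma_2)_{x,y}\circ\iota_{x\otimes y}=\iota_x\otimes\iota_y$;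 $\sigma_0\circ\mu_{\mathbf 1}=\sigma_0\circ T(\sigma_0)$; $\sigma_0\circ\iota_{\mathbf 1}=\mathrm{id}_{\mathbf 1}$. A left antipode for a bimonad $T$ on a monoidal category with a left duality is a natural transformation $\mathsf S\colon T\circ{}^\vee\circ T^{\mathrm{op}}\Rightarrow{}^\vee$ such that for every object $x$: $$\mathsf{ev}_{T(x)}\circ\bigl((\mathsf S_{T(x)}\circ T({}^\vee\mu_x))\otimes\mathrm{id}_{T(x)}\bigr)\circ(\sigma_2)_{{}^\vee T(x),\,x}=\sigma_0\circ T(\mathsf{ev}_x)\circ T({}^\vee\iota_x\otimes\mathrm{id}_x),$$ $$(\mu_x\otimes\mathsf S_x)\circ(\sigma_2)_{T(x),\,{}^\vee T(x)}\circ T(\mathsf{coev}_{T(x)})=(\iota_x\otimes\mathrm{id}_{{}^\vee x})\circ\mathsf{coev}_x\circ\sigma_0.$$ A strong monoidal functor $U$ has structure isomorphisms $\sigma^2_{d,d'}\colon U(d)\otimes U(d')\to U(d\otimes d')$ and $\sigma^0\colon\mathbf 1\to U(\mathbf 1)$. The bimonad structure on $T=U\circ F$ is: $\mu_x=U(\epsilon_{F(x)})$, $\iota_x=\eta_x$, $$(\sigma_2)_{x,y}=(\sigma^2_{F(x),F(y)})^{-1}\circ U(\epsilon_{F(x)\otimes F(y)})\circ UF(\sigma^2_{F(x),F(y)})\circ UF(\eta_x\otimes\eta_y),\qquad\sigma_0=(\sigma^0)^{-1}\circ U(\epsilon_{\mathbf 1})\circ UF(\sigma^0).$$ The isomorphism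 $\varphi_d\colon{}^\vee U(d)\to U({}^\vee d)$ is the composite $${}^\vee U(d)\to{}^\vee U(d)\otimes\mathbf 1\to{}^\vee U(d)\otimes U(\mathbf 1)\to{}^\vee U(d)\otimes U(d\otimes{}^\vee d)\to{}^\vee U(d)\otimes(U(d)\otimes U({}^\vee d))\to({}^\vee U(d)\otimes U(d))\otimes U({}^\vee d)\to\mathbf 1\otimes U({}^\vee d)\to U({}^\vee d),$$ whose maps are in order: the inverse right unit isomorphism, $\mathrm{id}\otimes\sigma^0$, $\mathrm{id}\otimes U(\mathsf{coev}_d)$, $\mathrm{id}\otimes(\sigma^2_{d,{}^\vee d})^{-1}$, the associativity isomorphism, $\mathsf{ev}_{U(d)}\otimes\mathrm{id}$, and the left unit isomorphism. It is a natural isomorphism ${}^\vee\circ U^{\mathrm{op}}\Rightarrow U\circ{}^\vee$. *)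

theory Defs
  imports Main
begin

section \<open>Categories, functors and natural transformations\<close>

record ('o, 'm) category =
  Obj :: "'o set"
  Mor :: "'m set"
  Dom :: "'m \<Rightarrow> 'o"
  Cod :: "'m \<Rightarrow> 'o"
  Ident :: "'o \<Rightarrow> 'm"
  Comp :: "'m \<Rightarrow> 'm \<Rightarrow> 'm"  (infixl "\<cdot>\<index>" 70)

definition Hom :: "('o, 'm, 'z) category_scheme \<Rightarrow> 'o \<Rightarrow> 'o \<Rightarrow> 'm set" where
  "Hom C a b = {f \<in> Mor C. Dom C f = a \<and> Cod C f = b}"

locale category =
  fixes C :: "('o, 'm, 'z) category_scheme" (structure)
  assumes Dom_in: "f \<in> Mor C \<Longrightarrow> Dom C f \<in> Obj C"
    and Cod_in: "f \<in> Mor C \<Longrightarrow> Cod C f \<in> Obj C"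
    and Ident_in: "a \<in> Obj C \<Longrightarrow> Ident C a \<in> Hom C a a"
    and Comp_in: "\<lbrakk>g \<in> Hom C b c; f \<in> Hom C a b\<rbrakk> \<Longrightarrow> g \<cdot> f \<in> Hom C a c"
    and Ident_left: "f \<in> Hom C a b \<Longrightarrow> Ident C b \<cdot> f = f"
    and Ident_right: "f \<in> Hom C a b \<Longrightarrow> f \<cdot> Ident C a = f"
    and Comp_assoc: "\<lbrakk>h \<in> Hom C c d; g \<in> Hom C b c; f \<in> Hom C a b\<rbrakk>
      \<Longrightarrow> (h \<cdot> g) \<cdot> f = h \<cdot> (g \<cdot> f)"

definition opp :: "('o, 'm, 'z) category_scheme \<Rightarrow> ('o, 'm) category" where
  "opp C = \<lparr>Obj = Obj C, Mor = Mor C, Dom = Cod C, Cod = Dom C, Ident = Ident C,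
            Comp = (\<lambda>g f. Comp C f g)\<rparr>"

definition inverse_pair :: "('o, 'm, 'z) category_scheme \<Rightarrow> 'm \<Rightarrow> 'm \<Rightarrow> bool" where
  "inverse_pair C f g \<longleftrightarrow> f \<in> Mor C \<and> g \<in> Hom C (Cod C f) (Dom C f) \<and>
     Comp C g f = Ident C (Dom C f) \<and> Comp C f g = Ident C (Cod C f)"

definition is_iso :: "('o, 'm, 'z) category_scheme \<Rightarrow> 'm \<Rightarrow> bool" where
  "is_iso C f \<longleftrightarrow> (\<exists>g. inverse_pair C f g)"

text \<open>The inverse of an isomorphism; no particular value is intended for other morphisms.\<close>

definition iso_inv :: "('o, 'm, 'z) category_scheme \<Rightarrow> 'm \<Rightarrow> 'm" where
  "iso_inv C f = (THE g. inverse_pair C f g)"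

text \<open>
  Source and target categories are not part of the data of a functor, so the opposite
  \<open>F\<^sup>o\<^sup>p\<close> of a functor is given by the same data as \<open>F\<close>.
\<close>

record ('a, 'f, 'b, 'g) functor_data =
  ob :: "'a \<Rightarrow> 'b"
  mor :: "'f \<Rightarrow> 'g"

definition id_functor :: "('a, 'f, 'a, 'f) functor_data" where
  "id_functor = \<lparr>ob = (\<lambda>a. a), mor = (\<lambda>f. f)\<rparr>"

definition comp_functor ::
  "('b, 'g, 'c, 'h) functor_data \<Rightarrow> ('a, 'f, 'b, 'g) functor_data \<Rightarrow> ('a, 'f, 'c, 'h) functor_data"
  (infixr "\<circ>\<^sub>F" 75) where
  "G \<circ>\<^sub>F F = \<lparr>ob = (\<lambda>a. ob G (ob F a)), mor = (\<lambda>f. mor G (mor F f))\<rparr>"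

locale category_functor = C: category C + D: category D
  for C :: "('a, 'f, 'y) category_scheme" and D :: "('b, 'g, 'z) category_scheme" +
  fixes F :: "('a, 'f, 'b, 'g) functor_data"
  assumes ob_in: "a \<in> Obj C \<Longrightarrow> ob F a \<in> Obj D"
    and mor_in: "f \<in> Hom C a b \<Longrightarrow> mor F f \<in> Hom D (ob F a) (ob F b)"
    and mor_Ident: "a \<in> Obj C \<Longrightarrow> mor F (Ident C a) = Ident D (ob F a)"
    and mor_Comp: "\<lbrakk>g \<in> Hom C b c; f \<in> Hom C a b\<rbrakk>
      \<Longrightarrow> mor F (g \<cdot>\<^bsub>C\<^esub> f) = mor F g \<cdot>\<^bsub>D\<^esub> mor F f"

locale natural_transformation = F: category_functor C D F + G: category_functor C D G
  for C :: "('a, 'f, 'y) category_scheme" and D :: "('b, 'g, 'z) category_scheme"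
    and F G :: "('a, 'f, 'b, 'g) functor_data" +
  fixes \<tau> :: "'a \<Rightarrow> 'g"
  assumes component_in: "a \<in> Obj C \<Longrightarrow> \<tau> a \<in> Hom D (ob F a) (ob G a)"
    and naturality: "f \<in> Hom C a b \<Longrightarrow> \<tau> b \<cdot>\<^bsub>D\<^esub> mor F f = mor G f \<cdot>\<^bsub>D\<^esub> \<tau> a"

locale adjunction = F: category_functor C D F + U: category_functor D C U +
    unit: natural_transformation C C id_functor "U \<circ>\<^sub>F F" \<eta> +
    counit: natural_transformation D D "F \<circ>\<^sub>F U" id_functor \<epsilon>
  for C :: "('a, 'f, 'y) category_scheme" and D :: "('b, 'g, 'z) category_scheme"
    and F :: "('a, 'f, 'b, 'g) functor_data" and U :: "('b, 'g, 'a, 'f) functor_data"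
    and \<eta> :: "'a \<Rightarrow> 'f" and \<epsilon> :: "'b \<Rightarrow> 'g" +
  assumes triangle_left: "x \<in> Obj C \<Longrightarrow>
      \<epsilon> (ob F x) \<cdot>\<^bsub>D\<^esub> mor F (\<eta> x) = Ident D (ob F x)"
    and triangle_right: "d \<in> Obj D \<Longrightarrow>
      mor U (\<epsilon> d) \<cdot>\<^bsub>C\<^esub> \<eta> (ob U d) = Ident C (ob U d)"


section \<open>Monoidal categories and strong monoidal functors\<close>

text \<open>
  \<open>\<otimes>\<close> is the tensor product of objects and \<open>\<boxtimes>\<close> that of morphisms. The constraints have components
  \<open>assoc x y z : (x \<otimes> y) \<otimes> z \<rightarrow> x \<otimes> (y \<otimes> z)\<close>, \<open>lunit x : \<one> \<otimes> x \<rightarrow> x\<close> and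
  \<open>runit x : x \<otimes> \<one> \<rightarrow> x\<close>.
\<close>

record ('o, 'm) monoidal_category = "('o, 'm) category" +
  tensor_ob :: "'o \<Rightarrow> 'o \<Rightarrow> 'o"  (infixl "\<otimes>\<index>" 75)
  tensor_mor :: "'m \<Rightarrow> 'm \<Rightarrow> 'm"  (infixl "\<boxtimes>\<index>" 75)
  unit_ob :: 'o  ("\<one>\<index>")
  assoc :: "'o \<Rightarrow> 'o \<Rightarrow> 'o \<Rightarrow> 'm"
  lunit :: "'o \<Rightarrow> 'm"
  runit :: "'o \<Rightarrow> 'm"

locale monoidal_category = category C
  for C :: "('o, 'm, 'z) monoidal_category_scheme" (structure) +
  assumes unit_ob_in: "\<one> \<in> Obj C"
    and tensor_ob_in: "\<lbrakk>x \<in> Obj C; y \<in> Obj C\<rbrakk> \<Longrightarrow> x \<otimes> y \<in> Obj C"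
    and tensor_mor_in: "\<lbrakk>f \<in> Hom C x x'; g \<in> Hom C y y'\<rbrakk>
      \<Longrightarrow> f \<boxtimes> g \<in> Hom C (x \<otimes> y) (x' \<otimes> y')"
    and tensor_Ident: "\<lbrakk>x \<in> Obj C; y \<in> Obj C\<rbrakk>
      \<Longrightarrow> Ident C x \<boxtimes> Ident C y = Ident C (x \<otimes> y)"
    and interchange: "\<lbrakk>f \<in> Hom C x x'; f' \<in> Hom C x' x''; g \<in> Hom C y y'; g' \<in> Hom C y' y''\<rbrakk>
      \<Longrightarrow> (f' \<cdot> f) \<boxtimes> (g' \<cdot> g) = (f' \<boxtimes> g') \<cdot> (f \<boxtimes> g)"
    and assoc_in: "\<lbrakk>x \<in> Obj C; y \<in> Obj C; z \<in> Obj C\<rbrakk>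
      \<Longrightarrow> assoc C x y z \<in> Hom C ((x \<otimes> y) \<otimes> z) (x \<otimes> (y \<otimes> z))"
    and assoc_iso: "\<lbrakk>x \<in> Obj C; y \<in> Obj C; z \<in> Obj C\<rbrakk> \<Longrightarrow> is_iso C (assoc C x y z)"
    and assoc_natural: "\<lbrakk>f \<in> Hom C x x'; g \<in> Hom C y y'; h \<in> Hom C z z'\<rbrakk>
      \<Longrightarrow> assoc C x' y' z' \<cdot> ((f \<boxtimes> g) \<boxtimes> h) = (f \<boxtimes> (g \<boxtimes> h)) \<cdot> assoc C x y z"
    and lunit_in: "x \<in> Obj C \<Longrightarrow> lunit C x \<in> Hom C (\<one> \<otimes> x) x"
    and lunit_iso: "x \<in> Obj C \<Longrightarrow> is_iso C (lunit C x)"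
    and lunit_natural: "f \<in> Hom C x x' \<Longrightarrow> lunit C x' \<cdot> (Ident C \<one> \<boxtimes> f) = f \<cdot> lunit C x"
    and runit_in: "x \<in> Obj C \<Longrightarrow> runit C x \<in> Hom C (x \<otimes> \<one>) x"
    and runit_iso: "x \<in> Obj C \<Longrightarrow> is_iso C (runit C x)"
    and runit_natural: "f \<in> Hom C x x' \<Longrightarrow> runit C x' \<cdot> (f \<boxtimes> Ident C \<one>) = f \<cdot> runit C x"
    and pentagon: "\<lbrakk>w \<in> Obj C; x \<in> Obj C; y \<in> Obj C; z \<in> Obj C\<rbrakk>
      \<Longrightarrow> assoc C w x (y \<otimes> z) \<cdot> assoc C (w \<otimes> x) y z
        = (Ident C w \<boxtimes> assoc C x y z) \<cdot> assoc C w (x \<otimes> y) z \<cdot> (assoc C w x y \<boxtimes> Ident C z)"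
    and triangle: "\<lbrakk>x \<in> Obj C; y \<in> Obj C\<rbrakk>
      \<Longrightarrow> (Ident C x \<boxtimes> lunit C y) \<cdot> assoc C x \<one> y = runit C x \<boxtimes> Ident C y"

locale strong_monoidal_functor = D: monoidal_category D + C: monoidal_category C +
    category_functor D C U
  for D :: "('b, 'g, 'y) monoidal_category_scheme"
    and C :: "('a, 'f, 'z) monoidal_category_scheme"
    and U :: "('b, 'g, 'a, 'f) functor_data" +
  fixes s2 :: "'b \<Rightarrow> 'b \<Rightarrow> 'f" and s0 :: 'f
  assumes s2_in: "\<lbrakk>d \<in> Obj D; e \<in> Obj D\<rbrakk>
      \<Longrightarrow> s2 d e \<in> Hom C (ob U d \<otimes>\<^bsub>C\<^esub> ob U e) (ob U (d \<otimes>\<^bsub>D\<^esub> e))"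
    and s2_iso: "\<lbrakk>d \<in> Obj D; e \<in> Obj D\<rbrakk> \<Longrightarrow> is_iso C (s2 d e)"
    and s2_natural: "\<lbrakk>f \<in> Hom D d d'; g \<in> Hom D e e'\<rbrakk>
      \<Longrightarrow> s2 d' e' \<cdot>\<^bsub>C\<^esub> (mor U f \<boxtimes>\<^bsub>C\<^esub> mor U g) = mor U (f \<boxtimes>\<^bsub>D\<^esub> g) \<cdot>\<^bsub>C\<^esub> s2 d e"
    and s0_in: "s0 \<in> Hom C \<one>\<^bsub>C\<^esub> (ob U \<one>\<^bsub>D\<^esub>)"
    and s0_iso: "is_iso C s0"
    and s2_assoc: "\<lbrakk>d \<in> Obj D; d' \<in> Obj D; d'' \<in> Obj D\<rbrakk>
      \<Longrightarrow> mor U (assoc D d d' d'') \<cdot>\<^bsub>C\<^esub> s2 (d \<otimes>\<^bsub>D\<^esub> d') d'' \<cdot>\<^bsub>C\<^esub> (s2 d d' \<boxtimes>\<^bsub>C\<^esub> Ident C (ob U d''))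
        = s2 d (d' \<otimes>\<^bsub>D\<^esub> d'') \<cdot>\<^bsub>C\<^esub> (Ident C (ob U d) \<boxtimes>\<^bsub>C\<^esub> s2 d' d'')
            \<cdot>\<^bsub>C\<^esub> assoc C (ob U d) (ob U d') (ob U d'')"
    and s2_lunit: "d \<in> Obj D
      \<Longrightarrow> mor U (lunit D d) \<cdot>\<^bsub>C\<^esub> s2 \<one>\<^bsub>D\<^esub> d \<cdot>\<^bsub>C\<^esub> (s0 \<boxtimes>\<^bsub>C\<^esub> Ident C (ob U d)) = lunit C (ob U d)"
    and s2_runit: "d \<in> Obj D
      \<Longrightarrow> mor U (runit D d) \<cdot>\<^bsub>C\<^esub> s2 d \<one>\<^bsub>D\<^esub> \<cdot>\<^bsub>C\<^esub> (Ident C (ob U d) \<boxtimes>\<^bsub>C\<^esub> s0) = runit C (ob U d)"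


section \<open>Left dualities\<close>

record ('o, 'm) duality_data =
  dual :: "('o, 'm, 'o, 'm) functor_data"
  ev :: "'o \<Rightarrow> 'm"
  coev :: "'o \<Rightarrow> 'm"

text \<open>The suppressed associativity and unit isomorphisms in the snake relations are inserted.\<close>

locale left_duality = monoidal_category C + dual: category_functor "opp C" C "dual L"
  for C :: "('o, 'm, 'z) monoidal_category_scheme" (structure)
    and L :: "('o, 'm) duality_data" +
  assumes ev_in: "a \<in> Obj C \<Longrightarrow> ev L a \<in> Hom C (ob (dual L) a \<otimes> a) \<one>"
    and coev_in: "a \<in> Obj C \<Longrightarrow> coev L a \<in> Hom C \<one> (a \<otimes> ob (dual L) a)"
    and ev_dinatural: "f \<in> Hom C a a' \<Longrightarrow>
      ev L a \<cdot> (mor (dual L) f \<boxtimes> Ident C a) = ev L a' \<cdot> (Ident C (ob (dual L) a') \<boxtimes> f)"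
    and coev_dinatural: "f \<in> Hom C a a' \<Longrightarrow>
      (f \<boxtimes> Ident C (ob (dual L) a)) \<cdot> coev L a = (Ident C a' \<boxtimes> mor (dual L) f) \<cdot> coev L a'"
    and snake_ob: "a \<in> Obj C \<Longrightarrow>
      runit C a \<cdot> (Ident C a \<boxtimes> ev L a) \<cdot> assoc C a (ob (dual L) a) a
        \<cdot> (coev L a \<boxtimes> Ident C a) \<cdot> iso_inv C (lunit C a) = Ident C a"
    and snake_dual: "a \<in> Obj C \<Longrightarrow>
      lunit C (ob (dual L) a) \<cdot> (ev L a \<boxtimes> Ident C (ob (dual L) a))
        \<cdot> iso_inv C (assoc C (ob (dual L) a) a (ob (dual L) a))
        \<cdot> (Ident C (ob (dual L) a) \<boxtimes> coev L a) \<cdot> iso_inv C (runit C (ob (dual L) a))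
        = Ident C (ob (dual L) a)"


section \<open>Bimonads and left antipodes\<close>

record ('o, 'm) bimonad_data =
  endo :: "('o, 'm, 'o, 'm) functor_data"
  mult :: "'o \<Rightarrow> 'm"  ("\<mu>\<index>")
  unit :: "'o \<Rightarrow> 'm"  ("\<iota>\<index>")
  opmon2 :: "'o \<Rightarrow> 'o \<Rightarrow> 'm"  ("\<sigma>\<^sub>2\<index>")
  opmon0 :: 'm  ("\<sigma>\<^sub>0\<index>")

locale monad =
    mult: natural_transformation C C "endo T \<circ>\<^sub>F endo T" "endo T" "\<mu>\<^bsub>T\<^esub>" +
    unit: natural_transformation C C id_functor "endo T" "\<iota>\<^bsub>T\<^esub>"
  for C :: "('o, 'm, 'z) category_scheme" and T :: "('o, 'm) bimonad_data" +
  assumes mult_assoc: "x \<in> Obj C \<Longrightarrow>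
      \<mu>\<^bsub>T\<^esub> x \<cdot>\<^bsub>C\<^esub> mor (endo T) (\<mu>\<^bsub>T\<^esub> x) = \<mu>\<^bsub>T\<^esub> x \<cdot>\<^bsub>C\<^esub> \<mu>\<^bsub>T\<^esub> (ob (endo T) x)"
    and mult_unit_left: "x \<in> Obj C \<Longrightarrow>
      \<mu>\<^bsub>T\<^esub> x \<cdot>\<^bsub>C\<^esub> \<iota>\<^bsub>T\<^esub> (ob (endo T) x) = Ident C (ob (endo T) x)"
    and mult_unit_right: "x \<in> Obj C \<Longrightarrow>
      \<mu>\<^bsub>T\<^esub> x \<cdot>\<^bsub>C\<^esub> mor (endo T) (\<iota>\<^bsub>T\<^esub> x) = Ident C (ob (endo T) x)"

locale opmonoidal_functor = C: monoidal_category C + endo: category_functor C C "endo T"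
  for C :: "('o, 'm, 'z) monoidal_category_scheme" and T :: "('o, 'm) bimonad_data" +
  assumes opmon2_in: "\<lbrakk>x \<in> Obj C; y \<in> Obj C\<rbrakk> \<Longrightarrow>
      \<sigma>\<^sub>2\<^bsub>T\<^esub> x y \<in> Hom C (ob (endo T) (x \<otimes>\<^bsub>C\<^esub> y)) (ob (endo T) x \<otimes>\<^bsub>C\<^esub> ob (endo T) y)"
    and opmon2_natural: "\<lbrakk>f \<in> Hom C x x'; g \<in> Hom C y y'\<rbrakk> \<Longrightarrow>
      \<sigma>\<^sub>2\<^bsub>T\<^esub> x' y' \<cdot>\<^bsub>C\<^esub> mor (endo T) (f \<boxtimes>\<^bsub>C\<^esub> g)
        = (mor (endo T) f \<boxtimes>\<^bsub>C\<^esub> mor (endo T) g) \<cdot>\<^bsub>C\<^esub> \<sigma>\<^sub>2\<^bsub>T\<^esub> x y"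
    and opmon0_in: "\<sigma>\<^sub>0\<^bsub>T\<^esub> \<in> Hom C (ob (endo T) \<one>\<^bsub>C\<^esub>) \<one>\<^bsub>C\<^esub>"
    and opmon_coassoc: "\<lbrakk>x \<in> Obj C; y \<in> Obj C; z \<in> Obj C\<rbrakk> \<Longrightarrow>
      assoc C (ob (endo T) x) (ob (endo T) y) (ob (endo T) z)
          \<cdot>\<^bsub>C\<^esub> (\<sigma>\<^sub>2\<^bsub>T\<^esub> x y \<boxtimes>\<^bsub>C\<^esub> Ident C (ob (endo T) z)) \<cdot>\<^bsub>C\<^esub> \<sigma>\<^sub>2\<^bsub>T\<^esub> (x \<otimes>\<^bsub>C\<^esub> y) z
        = (Ident C (ob (endo T) x) \<boxtimes>\<^bsub>C\<^esub> \<sigma>\<^sub>2\<^bsub>T\<^esub> y z) \<cdot>\<^bsub>C\<^esub> \<sigma>\<^sub>2\<^bsub>T\<^esub> x (y \<otimes>\<^bsub>C\<^esub> z)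
          \<cdot>\<^bsub>C\<^esub> mor (endo T) (assoc C x y z)"
    and opmon_counit_left: "x \<in> Obj C \<Longrightarrow>
      lunit C (ob (endo T) x) \<cdot>\<^bsub>C\<^esub> (\<sigma>\<^sub>0\<^bsub>T\<^esub> \<boxtimes>\<^bsub>C\<^esub> Ident C (ob (endo T) x)) \<cdot>\<^bsub>C\<^esub> \<sigma>\<^sub>2\<^bsub>T\<^esub> \<one>\<^bsub>C\<^esub> x
        = mor (endo T) (lunit C x)"
    and opmon_counit_right: "x \<in> Obj C \<Longrightarrow>
      runit C (ob (endo T) x) \<cdot>\<^bsub>C\<^esub> (Ident C (ob (endo T) x) \<boxtimes>\<^bsub>C\<^esub> \<sigma>\<^sub>0\<^bsub>T\<^esub>) \<cdot>\<^bsub>C\<^esub> \<sigma>\<^sub>2\<^bsub>T\<^esub> x \<one>\<^bsub>C\<^esub>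
        = mor (endo T) (runit C x)"

locale bimonad = monad C T + opmonoidal_functor C T
  for C :: "('o, 'm, 'z) monoidal_category_scheme" and T :: "('o, 'm) bimonad_data" +
  assumes opmon2_mult: "\<lbrakk>x \<in> Obj C; y \<in> Obj C\<rbrakk> \<Longrightarrow>
      \<sigma>\<^sub>2\<^bsub>T\<^esub> x y \<cdot>\<^bsub>C\<^esub> \<mu>\<^bsub>T\<^esub> (x \<otimes>\<^bsub>C\<^esub> y)
        = (\<mu>\<^bsub>T\<^esub> x \<boxtimes>\<^bsub>C\<^esub> \<mu>\<^bsub>T\<^esub> y) \<cdot>\<^bsub>C\<^esub> \<sigma>\<^sub>2\<^bsub>T\<^esub> (ob (endo T) x) (ob (endo T) y)
          \<cdot>\<^bsub>C\<^esub> mor (endo T) (\<sigma>\<^sub>2\<^bsub>T\<^esub> x y)"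
    and opmon2_unit: "\<lbrakk>x \<in> Obj C; y \<in> Obj C\<rbrakk> \<Longrightarrow>
      \<sigma>\<^sub>2\<^bsub>T\<^esub> x y \<cdot>\<^bsub>C\<^esub> \<iota>\<^bsub>T\<^esub> (x \<otimes>\<^bsub>C\<^esub> y) = \<iota>\<^bsub>T\<^esub> x \<boxtimes>\<^bsub>C\<^esub> \<iota>\<^bsub>T\<^esub> y"
    and opmon0_mult: "\<sigma>\<^sub>0\<^bsub>T\<^esub> \<cdot>\<^bsub>C\<^esub> \<mu>\<^bsub>T\<^esub> \<one>\<^bsub>C\<^esub> = \<sigma>\<^sub>0\<^bsub>T\<^esub> \<cdot>\<^bsub>C\<^esub> mor (endo T) \<sigma>\<^sub>0\<^bsub>T\<^esub>"
    and opmon0_unit: "\<sigma>\<^sub>0\<^bsub>T\<^esub> \<cdot>\<^bsub>C\<^esub> \<iota>\<^bsub>T\<^esub> \<one>\<^bsub>C\<^esub> = Ident C \<one>\<^bsub>C\<^esub>"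

locale left_antipode = left_duality C L + bimonad C T +
    natural_transformation "opp C" C "endo T \<circ>\<^sub>F dual L \<circ>\<^sub>F endo T" "dual L" S
  for C :: "('o, 'm, 'z) monoidal_category_scheme" and L :: "('o, 'm) duality_data"
    and T :: "('o, 'm) bimonad_data" and S :: "'o \<Rightarrow> 'm" +
  assumes antipode_ev: "x \<in> Obj C \<Longrightarrow>
      ev L (ob (endo T) x)
        \<cdot>\<^bsub>C\<^esub> ((S (ob (endo T) x) \<cdot>\<^bsub>C\<^esub> mor (endo T) (mor (dual L) (\<mu>\<^bsub>T\<^esub> x)))
              \<boxtimes>\<^bsub>C\<^esub> Ident C (ob (endo T) x))
        \<cdot>\<^bsub>C\<^esub> \<sigma>\<^sub>2\<^bsub>T\<^esub> (ob (dual L) (ob (endo T) x)) x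
      = \<sigma>\<^sub>0\<^bsub>T\<^esub> \<cdot>\<^bsub>C\<^esub> mor (endo T) (ev L x)
        \<cdot>\<^bsub>C\<^esub> mor (endo T) (mor (dual L) (\<iota>\<^bsub>T\<^esub> x) \<boxtimes>\<^bsub>C\<^esub> Ident C x)"
    and antipode_coev: "x \<in> Obj C \<Longrightarrow>
      (\<mu>\<^bsub>T\<^esub> x \<boxtimes>\<^bsub>C\<^esub> S x) \<cdot>\<^bsub>C\<^esub> \<sigma>\<^sub>2\<^bsub>T\<^esub> (ob (endo T) x) (ob (dual L) (ob (endo T) x))
        \<cdot>\<^bsub>C\<^esub> mor (endo T) (coev L (ob (endo T) x))
      = (\<iota>\<^bsub>T\<^esub> x \<boxtimes>\<^bsub>C\<^esub> Ident C (ob (dual L) x)) \<cdot>\<^bsub>C\<^esub> coev L x \<cdot>\<^bsub>C\<^esub> \<sigma>\<^sub>0\<^bsub>T\<^esub>"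


section \<open>The bimonad and the antipode of an adjunction with strong monoidal right adjoint\<close>

definition adjunction_bimonad ::
  "('a, 'f, 'y) monoidal_category_scheme \<Rightarrow> ('b, 'g, 'z) monoidal_category_scheme
    \<Rightarrow> ('a, 'f, 'b, 'g) functor_data \<Rightarrow> ('b, 'g, 'a, 'f) functor_data
    \<Rightarrow> ('a \<Rightarrow> 'f) \<Rightarrow> ('b \<Rightarrow> 'g) \<Rightarrow> ('b \<Rightarrow> 'b \<Rightarrow> 'f) \<Rightarrow> 'f \<Rightarrow> ('a, 'f) bimonad_data" where
  "adjunction_bimonad C D F U \<eta> \<epsilon> s2 s0 =
    \<lparr>endo = U \<circ>\<^sub>F F,
     mult = (\<lambda>x. mor U (\<epsilon> (ob F x))),
     unit = \<eta>,
     opmon2 = (\<lambda>x y.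
       iso_inv C (s2 (ob F x) (ob F y))
       \<cdot>\<^bsub>C\<^esub> mor U (\<epsilon> (ob F x \<otimes>\<^bsub>D\<^esub> ob F y))
       \<cdot>\<^bsub>C\<^esub> mor U (mor F (s2 (ob F x) (ob F y)))
       \<cdot>\<^bsub>C\<^esub> mor U (mor F (\<eta> x \<boxtimes>\<^bsub>C\<^esub> \<eta> y))),
     opmon0 = iso_inv C s0 \<cdot>\<^bsub>C\<^esub> mor U (\<epsilon> \<one>\<^bsub>D\<^esub>) \<cdot>\<^bsub>C\<^esub> mor U (mor F s0)\<rparr>"

definition canonical_dual_iso ::
  "('a, 'f, 'y) monoidal_category_scheme \<Rightarrow> ('b, 'g, 'z) monoidal_category_scheme
    \<Rightarrow> ('a, 'f) duality_data \<Rightarrow> ('b, 'g) duality_data \<Rightarrow> ('b, 'g, 'a, 'f) functor_data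
    \<Rightarrow> ('b \<Rightarrow> 'b \<Rightarrow> 'f) \<Rightarrow> 'f \<Rightarrow> 'b \<Rightarrow> 'f" where
  "canonical_dual_iso C D L M U s2 s0 d =
    (let Ud = ob U d; Ud' = ob (dual L) (ob U d); Udd = ob U (ob (dual M) d) in
      lunit C Udd
      \<cdot>\<^bsub>C\<^esub> (ev L Ud \<boxtimes>\<^bsub>C\<^esub> Ident C Udd)
      \<cdot>\<^bsub>C\<^esub> iso_inv C (assoc C Ud' Ud Udd)
      \<cdot>\<^bsub>C\<^esub> (Ident C Ud' \<boxtimes>\<^bsub>C\<^esub> iso_inv C (s2 d (ob (dual M) d)))
      \<cdot>\<^bsub>C\<^esub> (Ident C Ud' \<boxtimes>\<^bsub>C\<^esub> mor U (coev M d))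
      \<cdot>\<^bsub>C\<^esub> (Ident C Ud' \<boxtimes>\<^bsub>C\<^esub> s0)
      \<cdot>\<^bsub>C\<^esub> iso_inv C (runit C Ud'))"

definition adjunction_antipode ::
  "('a, 'f, 'y) monoidal_category_scheme \<Rightarrow> ('b, 'g, 'z) monoidal_category_scheme
    \<Rightarrow> ('a, 'f) duality_data \<Rightarrow> ('b, 'g) duality_data
    \<Rightarrow> ('a, 'f, 'b, 'g) functor_data \<Rightarrow> ('b, 'g, 'a, 'f) functor_data
    \<Rightarrow> ('a \<Rightarrow> 'f) \<Rightarrow> ('b \<Rightarrow> 'g) \<Rightarrow> ('b \<Rightarrow> 'b \<Rightarrow> 'f) \<Rightarrow> 'f \<Rightarrow> 'a \<Rightarrow> 'f" where
  "adjunction_antipode C D L M F U \<eta> \<epsilon> s2 s0 x =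
    (let \<phi> = canonical_dual_iso C D L M U s2 s0 in
      mor (dual L) (\<eta> x)
      \<cdot>\<^bsub>C\<^esub> iso_inv C (\<phi> (ob F x))
      \<cdot>\<^bsub>C\<^esub> mor U (\<epsilon> (ob (dual M) (ob F x)))
      \<cdot>\<^bsub>C\<^esub> mor U (mor F (\<phi> (ob F x))))"

end

theory Submission
  imports Defs
begin

text \<open>
  Transport the bijection \<open>Hom(F x, d) \<cong> Hom(x, U d)\<close> along \<open>U\<close>: every \<open>f : x \<rightarrow> U d\<close> has an extension
  \<open>ext d f = U \<epsilon> \<circ> U F f : T x \<rightarrow> U d\<close>, with \<open>U g \<circ> ext d f = ext d' (U g \<circ> f)\<close>,
  \<open>ext d f \<circ> T h = ext d (f \<circ> h)\<close> and \<open>ext d f \<circ> \<eta> = f\<close>. All structure morphisms of the bimonad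
  and of the antipode are extensions up to isomorphisms: \<open>\<sigma>\<^sub>2 = s2\<^sup>-\<^sup>1 \<circ> ext (s2 \<circ> (\<eta> \<boxtimes> \<eta>))\<close>,
  \<open>\<sigma>\<^sub>0 = s0\<^sup>-\<^sup>1 \<circ> ext s0\<close> and \<open>S = dual \<eta> \<circ> \<phi>\<^sup>-\<^sup>1 \<circ> ext \<phi>\<close>. An identity between composites therefore
  reduces to one between the morphisms that are extended.

  The only input about dualities is that \<open>U (dual d)\<close> is a dual of \<open>U d\<close>, with evaluation
  \<open>s0\<^sup>-\<^sup>1 \<circ> U ev \<circ> s2\<close> and coevaluation \<open>s2\<^sup>-\<^sup>1 \<circ> U coev \<circ> s0\<close>, and that \<open>\<phi>\<close> is the comparison
  isomorphism, compatible with both evaluations and both coevaluations.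
\<close>


section \<open>Categories, functors and coherence in monoidal categories\<close>

lemma Hom_iff: "f \<in> Hom C a b \<longleftrightarrow> f \<in> Mor C \<and> Dom C f = a \<and> Cod C f = b"
  by (auto simp: Hom_def)

lemma opp_simps [simp]:
  "Obj (opp C) = Obj C" "Mor (opp C) = Mor C" "Dom (opp C) = Cod C" "Cod (opp C) = Dom C"
  "Ident (opp C) = Ident C" "Comp (opp C) g f = Comp C f g"
  by (auto simp: opp_def)

lemma comp_functor_simps [simp]:
  "ob (G \<circ>\<^sub>F F) a = ob G (ob F a)" "mor (G \<circ>\<^sub>F F) f = mor G (mor F f)"
  by (auto simp: comp_functor_def)

lemma id_functor_simps [simp]: "ob id_functor a = a" "mor id_functor f = f"
  by (auto simp: id_functor_def)

section \<open>Composition and inverses in a category\<close>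

context category
begin

lemma Dom_Obj [simp]: "f \<in> Mor C \<Longrightarrow> Dom C f \<in> Obj C"
  by (rule Dom_in)

lemma Cod_Obj [simp]: "f \<in> Mor C \<Longrightarrow> Cod C f \<in> Obj C"
  by (rule Cod_in)

lemma Ident_simps [simp]:
  assumes "a \<in> Obj C"
  shows "Ident C a \<in> Mor C" "Dom C (Ident C a) = a" "Cod C (Ident C a) = a"
  using Ident_in[OF assms] by (auto simp: Hom_iff)

lemma Comp_simps [simp]:
  assumes "g \<in> Mor C" "f \<in> Mor C" "Dom C g = Cod C f"
  shows "g \<cdot> f \<in> Mor C" "Dom C (g \<cdot> f) = Dom C f" "Cod C (g \<cdot> f) = Cod C g"
  using Comp_in[of g "Cod C f" "Cod C g" f "Dom C f"] assms by (auto simp: Hom_iff)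

lemma Comp_Ident_left [simp]: "f \<in> Mor C \<Longrightarrow> Cod C f = a \<Longrightarrow> Ident C a \<cdot> f = f"
  using Ident_left[of f "Dom C f" a] by (auto simp: Hom_iff)

lemma Comp_Ident_right [simp]: "f \<in> Mor C \<Longrightarrow> Dom C f = a \<Longrightarrow> f \<cdot> Ident C a = f"
  using Ident_right[of f a "Cod C f"] by (auto simp: Hom_iff)

lemma Comp_Comp [simp]:
  assumes "h \<in> Mor C" "g \<in> Mor C" "f \<in> Mor C" "Dom C h = Cod C g" "Dom C g = Cod C f"
  shows "(h \<cdot> g) \<cdot> f = h \<cdot> (g \<cdot> f)"
  using Comp_assoc[of h "Cod C g" "Cod C h" g "Cod C f" f "Dom C f"] assms by (auto simp: Hom_iff)

text \<open>Composites are kept nested to the right, where an equation for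
  \<open>g \<cdot> f\<close> no longer matches if something stands to the right of \<open>f\<close>.
  This supplies the version with an arbitrary tail \<open>k\<close>, so that every naturality or
  coherence law can be used inside a longer composite.\<close>

lemma Comp_extend:
  assumes "g \<cdot> f = h" "g \<in> Mor C" "f \<in> Mor C" "Dom C g = Cod C f" "k \<in> Mor C" "Cod C k = Dom C f"
  shows "g \<cdot> (f \<cdot> k) = h \<cdot> k"
  using assms by (metis Comp_Comp)

lemma Comp_extend3:
  assumes "g \<cdot> (f \<cdot> l) = h" "g \<in> Mor C" "f \<in> Mor C" "l \<in> Mor C" "Dom C g = Cod C f"
    "Dom C f = Cod C l" "k \<in> Mor C" "Cod C k = Dom C l"
  shows "g \<cdot> (f \<cdot> (l \<cdot> k)) = h \<cdot> k"
  using assms by (metis Comp_Comp Comp_simps)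

lemma inverse_pair_iff:
  "inverse_pair C f g \<longleftrightarrow> f \<in> Mor C \<and> g \<in> Mor C \<and> Dom C g = Cod C f \<and> Cod C g = Dom C f
    \<and> g \<cdot> f = Ident C (Dom C f) \<and> f \<cdot> g = Ident C (Cod C f)"
  by (auto simp: inverse_pair_def Hom_iff)

lemma inverse_pair_unique: "inverse_pair C f g \<Longrightarrow> inverse_pair C f h \<Longrightarrow> g = h"
  unfolding inverse_pair_iff by (metis Comp_Comp Comp_Ident_left Comp_Ident_right)

text \<open>\<open>iso_inv\<close> is a definite description, so uniqueness of two-sided inverses is
  what makes it computable: to evaluate it, exhibit any inverse.\<close>

lemma iso_inv_eq: "inverse_pair C f g \<Longrightarrow> iso_inv C f = g"
  unfolding iso_inv_def using inverse_pair_unique by blast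

lemma inverse_pair_iso_inv: "is_iso C f \<Longrightarrow> inverse_pair C f (iso_inv C f)"
  using iso_inv_eq unfolding is_iso_def by metis

lemma iso_inv_simps [simp]:
  assumes "is_iso C f"
  shows "f \<in> Mor C" "iso_inv C f \<in> Mor C" "Dom C (iso_inv C f) = Cod C f"
    "Cod C (iso_inv C f) = Dom C f"
    "iso_inv C f \<cdot> f = Ident C (Dom C f)" "f \<cdot> iso_inv C f = Ident C (Cod C f)"
  using inverse_pair_iso_inv[OF assms] by (auto simp: inverse_pair_iff)

lemma iso_inv_cancel [simp]:
  assumes "is_iso C f"
  shows "k \<in> Mor C \<Longrightarrow> Cod C k = Dom C f \<Longrightarrow> iso_inv C f \<cdot> (f \<cdot> k) = k"
    "k \<in> Mor C \<Longrightarrow> Cod C k = Cod C f \<Longrightarrow> f \<cdot> (iso_inv C f \<cdot> k) = k"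
  using assms by (simp_all flip: Comp_Comp)

lemma iso_inv_Comp_eq_iff:
  assumes "is_iso C f" "g \<in> Mor C" "h \<in> Mor C" "Cod C g = Cod C f" "Cod C h = Dom C f"
  shows "iso_inv C f \<cdot> g = h \<longleftrightarrow> g = f \<cdot> h"
  using assms by auto

lemma Comp_iso_inv_eq_iff:
  assumes "is_iso C f" "g \<in> Mor C" "h \<in> Mor C" "Dom C g = Dom C f" "Dom C h = Cod C f"
  shows "g \<cdot> iso_inv C f = h \<longleftrightarrow> g = h \<cdot> f"
  using assms by auto

lemma iso_cancel_left:
  assumes "is_iso C f" "f \<cdot> g = f \<cdot> h" "g \<in> Mor C" "h \<in> Mor C" "Cod C g = Dom C f" "Cod C h = Dom C f"
  shows "g = h"
  using assms by (metis iso_inv_cancel(1))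

lemma iso_cancel_right:
  assumes "is_iso C f" "g \<cdot> f = h \<cdot> f" "g \<in> Mor C" "h \<in> Mor C" "Dom C g = Cod C f" "Dom C h = Cod C f"
  shows "g = h"
proof -
  have "(g \<cdot> f) \<cdot> iso_inv C f = (h \<cdot> f) \<cdot> iso_inv C f"
    by (simp only: assms(2))
  then show ?thesis
    using assms(1,3-) by simp
qed

lemma category_opp: "category (opp C)"
  by unfold_locales (auto simp: Hom_iff)

end

section \<open>Functors and natural transformations\<close>

context category_functor
begin

lemma ob_Obj [simp]: "a \<in> Obj C \<Longrightarrow> ob F a \<in> Obj D"
  by (rule ob_in)

lemma mor_simps [simp]:
  assumes "f \<in> Mor C"
  shows "mor F f \<in> Mor D" "Dom D (mor F f) = ob F (Dom C f)" "Cod D (mor F f) = ob F (Cod C f)"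
  using mor_in[of f "Dom C f" "Cod C f"] assms by (auto simp: Hom_iff)

lemma mor_Ident' [simp]: "a \<in> Obj C \<Longrightarrow> mor F (Ident C a) = Ident D (ob F a)"
  by (rule mor_Ident)

lemma mor_Comp' [simp]:
  assumes "g \<in> Mor C" "f \<in> Mor C" "Dom C g = Cod C f"
  shows "mor F (g \<cdot>\<^bsub>C\<^esub> f) = mor F g \<cdot>\<^bsub>D\<^esub> mor F f"
  using mor_Comp[of g "Cod C f" "Cod C g" f "Dom C f"] assms by (auto simp: Hom_iff)

lemma is_iso_mor:
  assumes "is_iso C f"
  shows "is_iso D (mor F f)" "iso_inv D (mor F f) = mor F (iso_inv C f)"
proof -
  have "inverse_pair D (mor F f) (mor F (iso_inv C f))"
    using assms by (simp add: D.inverse_pair_iff flip: mor_Comp')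
  then show "is_iso D (mor F f)" "iso_inv D (mor F f) = mor F (iso_inv C f)"
    by (auto simp: is_iso_def D.iso_inv_eq)
qed

end

lemma category_functor_comp:
  assumes "category_functor A B F" "category_functor B C G"
  shows "category_functor A C (G \<circ>\<^sub>F F)"
proof -
  interpret F: category_functor A B F by fact
  interpret G: category_functor B C G by fact
  show ?thesis
    by unfold_locales (auto simp: Hom_iff)
qed

context natural_transformation
begin

lemma component_simps [simp]:
  assumes "a \<in> Obj C"
  shows "\<tau> a \<in> Mor D" "Dom D (\<tau> a) = ob F a" "Cod D (\<tau> a) = ob G a"
  using component_in[OF assms] by (auto simp: Hom_iff)

lemma naturality': "f \<in> Mor C \<Longrightarrow> \<tau> (Cod C f) \<cdot>\<^bsub>D\<^esub> mor F f = mor G f \<cdot>\<^bsub>D\<^esub> \<tau> (Dom C f)"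
  by (rule naturality) (auto simp: Hom_iff)

end

section \<open>Monoidal categories and the derived unit coherences\<close>

context monoidal_category
begin

lemma unit_ob_Obj [simp]: "\<one> \<in> Obj C"
  by (rule unit_ob_in)

lemma tensor_ob_Obj [simp]: "x \<in> Obj C \<Longrightarrow> y \<in> Obj C \<Longrightarrow> x \<otimes> y \<in> Obj C"
  by (rule tensor_ob_in)

lemma tensor_simps [simp]:
  assumes "f \<in> Mor C" "g \<in> Mor C"
  shows "f \<boxtimes> g \<in> Mor C" "Dom C (f \<boxtimes> g) = Dom C f \<otimes> Dom C g" "Cod C (f \<boxtimes> g) = Cod C f \<otimes> Cod C g"
  using tensor_mor_in[of f "Dom C f" "Cod C f" g "Dom C g" "Cod C g"] assms
  by (auto simp: Hom_iff)

lemma tensor_Ident' [simp]: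
  "x \<in> Obj C \<Longrightarrow> y \<in> Obj C \<Longrightarrow> Ident C x \<boxtimes> Ident C y = Ident C (x \<otimes> y)"
  by (rule tensor_Ident)

text \<open>The interchange law is oriented so that consecutive tensor products are merged into one.
  Steps in which a single tensor factor has to meet a naturality law remove this rule, to keep the
  factors apart.\<close>

lemma tensor_Comp [simp]:
  assumes "f \<in> Mor C" "f' \<in> Mor C" "g \<in> Mor C" "g' \<in> Mor C" "Dom C f' = Cod C f" "Dom C g' = Cod C g"
  shows "(f' \<boxtimes> g') \<cdot> (f \<boxtimes> g) = (f' \<cdot> f) \<boxtimes> (g' \<cdot> g)"
  using interchange[of f "Dom C f" "Cod C f" f' "Cod C f'" g "Dom C g" "Cod C g" g' "Cod C g'"] assms
  by (auto simp: Hom_iff)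

lemma tensor_Comp_extend [simp]:
  assumes "f \<in> Mor C" "f' \<in> Mor C" "g \<in> Mor C" "g' \<in> Mor C" "Dom C f' = Cod C f" "Dom C g' = Cod C g"
    "k \<in> Mor C" "Cod C k = Dom C f \<otimes> Dom C g"
  shows "(f' \<boxtimes> g') \<cdot> ((f \<boxtimes> g) \<cdot> k) = ((f' \<cdot> f) \<boxtimes> (g' \<cdot> g)) \<cdot> k"
  using assms by (simp add: Comp_extend[OF tensor_Comp])

lemma is_iso_tensor:
  assumes "is_iso C f" "is_iso C g"
  shows "is_iso C (f \<boxtimes> g)" "iso_inv C (f \<boxtimes> g) = iso_inv C f \<boxtimes> iso_inv C g"
proof -
  have "inverse_pair C (f \<boxtimes> g) (iso_inv C f \<boxtimes> iso_inv C g)"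
    using assms by (simp add: inverse_pair_iff)
  then show "is_iso C (f \<boxtimes> g)" "iso_inv C (f \<boxtimes> g) = iso_inv C f \<boxtimes> iso_inv C g"
    by (auto simp: is_iso_def iso_inv_eq)
qed

lemma is_iso_Ident:
  assumes "a \<in> Obj C"
  shows "is_iso C (Ident C a)" "iso_inv C (Ident C a) = Ident C a"
proof -
  have "inverse_pair C (Ident C a) (Ident C a)"
    using assms by (simp add: inverse_pair_iff)
  then show "is_iso C (Ident C a)" "iso_inv C (Ident C a) = Ident C a"
    by (auto simp: is_iso_def iso_inv_eq)
qed

lemma assoc_simps [simp]:
  assumes "x \<in> Obj C" "y \<in> Obj C" "z \<in> Obj C"
  shows "assoc C x y z \<in> Mor C" "Dom C (assoc C x y z) = (x \<otimes> y) \<otimes> z"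
    "Cod C (assoc C x y z) = x \<otimes> (y \<otimes> z)" "is_iso C (assoc C x y z)"
  using assoc_in[OF assms] assoc_iso[OF assms] by (auto simp: Hom_iff)

lemma lunit_simps [simp]:
  assumes "x \<in> Obj C"
  shows "lunit C x \<in> Mor C" "Dom C (lunit C x) = \<one> \<otimes> x" "Cod C (lunit C x) = x"
    "is_iso C (lunit C x)"
  using lunit_in[OF assms] lunit_iso[OF assms] by (auto simp: Hom_iff)

lemma runit_simps [simp]:
  assumes "x \<in> Obj C"
  shows "runit C x \<in> Mor C" "Dom C (runit C x) = x \<otimes> \<one>" "Cod C (runit C x) = x"
    "is_iso C (runit C x)"
  using runit_in[OF assms] runit_iso[OF assms] by (auto simp: Hom_iff)

lemma assoc_naturality:
  assumes "f \<in> Mor C" "g \<in> Mor C" "h \<in> Mor C"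
  shows "assoc C (Cod C f) (Cod C g) (Cod C h) \<cdot> ((f \<boxtimes> g) \<boxtimes> h)
    = (f \<boxtimes> (g \<boxtimes> h)) \<cdot> assoc C (Dom C f) (Dom C g) (Dom C h)"
  using assms by (intro assoc_natural) (auto simp: Hom_iff)

lemma assoc_inv_naturality:
  assumes "f \<in> Mor C" "g \<in> Mor C" "h \<in> Mor C"
  shows "iso_inv C (assoc C (Cod C f) (Cod C g) (Cod C h)) \<cdot> (f \<boxtimes> (g \<boxtimes> h))
    = ((f \<boxtimes> g) \<boxtimes> h) \<cdot> iso_inv C (assoc C (Dom C f) (Dom C g) (Dom C h))"
  using assms by (simp add: iso_inv_Comp_eq_iff Comp_extend[OF assoc_naturality])

lemma lunit_naturality:
  "f \<in> Mor C \<Longrightarrow> lunit C (Cod C f) \<cdot> (Ident C \<one> \<boxtimes> f) = f \<cdot> lunit C (Dom C f)"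
  by (rule lunit_natural) (auto simp: Hom_iff)

lemma runit_naturality:
  "f \<in> Mor C \<Longrightarrow> runit C (Cod C f) \<cdot> (f \<boxtimes> Ident C \<one>) = f \<cdot> runit C (Dom C f)"
  by (rule runit_natural) (auto simp: Hom_iff)

lemma lunit_inv_naturality:
  "f \<in> Mor C \<Longrightarrow> iso_inv C (lunit C (Cod C f)) \<cdot> f = (Ident C \<one> \<boxtimes> f) \<cdot> iso_inv C (lunit C (Dom C f))"
  by (simp add: iso_inv_Comp_eq_iff Comp_extend[OF lunit_naturality])

lemma runit_inv_naturality:
  "f \<in> Mor C \<Longrightarrow> iso_inv C (runit C (Cod C f)) \<cdot> f = (f \<boxtimes> Ident C \<one>) \<cdot> iso_inv C (runit C (Dom C f))"
  by (simp add: iso_inv_Comp_eq_iff Comp_extend[OF runit_naturality])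

text \<open>By naturality, \<open>f\<close> composed with a left unitor is determined by
  \<open>Ident C \<one> \<boxtimes> f\<close>, and the unitor is invertible. Coherence identities
  may thus be checked after tensoring with the unit object, where the pentagon and the triangle
  become applicable.\<close>

lemma unit_tensor_faithful:
  assumes "Ident C \<one> \<boxtimes> f = Ident C \<one> \<boxtimes> g" "f \<in> Mor C" "g \<in> Mor C" "Dom C f = Dom C g" "Cod C f = Cod C g"
  shows "f = g"
  using lunit_naturality[of f] lunit_naturality[of g] assms
  by (metis Dom_Obj lunit_simps(3,4) iso_cancel_right)

lemma tensor_unit_faithful:
  assumes "f \<boxtimes> Ident C \<one> = g \<boxtimes> Ident C \<one>" "f \<in> Mor C" "g \<in> Mor C" "Dom C f = Dom C g" "Cod C f = Cod C g"
  shows "f = g"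
  using runit_naturality[of f] runit_naturality[of g] assms
  by (metis Dom_Obj runit_simps(3,4) iso_cancel_right)

lemma pentagon':
  assumes "w \<in> Obj C" "x \<in> Obj C" "y \<in> Obj C" "z \<in> Obj C"
  shows "assoc C w x (y \<otimes> z) \<cdot> assoc C (w \<otimes> x) y z
    = (Ident C w \<boxtimes> assoc C x y z) \<cdot> (assoc C w (x \<otimes> y) z \<cdot> (assoc C w x y \<boxtimes> Ident C z))"
  using pentagon[OF assms] assms by simp

text \<open>Kelly's argument: tensor both sides with the unit object on the left and precompose with
  the two associators in \<open>?a\<close>. The pentagon followed by the triangle turns one side
  into the other, using naturality of the associator at \<open>runit C \<one>\<close> and at
  \<open>lunit C x\<close>.\<close>

lemma lunit_tensor:
  assumes [simp]: "x \<in> Obj C" "y \<in> Obj C"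
  shows "lunit C (x \<otimes> y) \<cdot> assoc C \<one> x y = lunit C x \<boxtimes> Ident C y"
proof (rule unit_tensor_faithful)
  let ?a = "assoc C \<one> (\<one> \<otimes> x) y \<cdot> (assoc C \<one> \<one> x \<boxtimes> Ident C y)"
  have iso: "is_iso C (assoc C \<one> \<one> x \<boxtimes> Ident C y)"
    by (simp add: is_iso_tensor is_iso_Ident)
  have "(Ident C \<one> \<boxtimes> (lunit C (x \<otimes> y) \<cdot> assoc C \<one> x y)) \<cdot> ?a
      = (Ident C \<one> \<boxtimes> lunit C (x \<otimes> y)) \<cdot> ((Ident C \<one> \<boxtimes> assoc C \<one> x y) \<cdot> ?a)"
    by simp
  also have "\<dots> = (Ident C \<one> \<boxtimes> lunit C (x \<otimes> y)) \<cdot> (assoc C \<one> \<one> (x \<otimes> y) \<cdot> assoc C (\<one> \<otimes> \<one>) x y)"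
    by (simp only: pentagon' assms unit_ob_Obj)
  also have "\<dots> = (runit C \<one> \<boxtimes> Ident C (x \<otimes> y)) \<cdot> assoc C (\<one> \<otimes> \<one>) x y"
    by (simp add: Comp_extend[OF triangle])
  also have "\<dots> = assoc C \<one> x y \<cdot> ((runit C \<one> \<boxtimes> Ident C x) \<boxtimes> Ident C y)"
    using assoc_naturality[of "runit C \<one>" "Ident C x" "Ident C y"] by simp
  also have "\<dots> = assoc C \<one> x y \<cdot> (((Ident C \<one> \<boxtimes> lunit C x) \<boxtimes> Ident C y) \<cdot> (assoc C \<one> \<one> x \<boxtimes> Ident C y))"
    by (simp add: triangle)
  also have "\<dots> = (Ident C \<one> \<boxtimes> (lunit C x \<boxtimes> Ident C y)) \<cdot> ?a"
    using Comp_extend[OF assoc_naturality[of "Ident C \<one>" "lunit C x" "Ident C y"]]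
    by (simp del: tensor_Comp tensor_Comp_extend)
  finally have "(Ident C \<one> \<boxtimes> (lunit C (x \<otimes> y) \<cdot> assoc C \<one> x y)) \<cdot> ?a
    = (Ident C \<one> \<boxtimes> (lunit C x \<boxtimes> Ident C y)) \<cdot> ?a" .
  \<comment> \<open>Regrouping exposes the two invertible factors of \<open>?a\<close> at the right
    end, where they are cancelled one after the other.\<close>
  then have "((Ident C \<one> \<boxtimes> (lunit C (x \<otimes> y) \<cdot> assoc C \<one> x y)) \<cdot> assoc C \<one> (\<one> \<otimes> x) y) \<cdot> (assoc C \<one> \<one> x \<boxtimes> Ident C y)
    = ((Ident C \<one> \<boxtimes> (lunit C x \<boxtimes> Ident C y)) \<cdot> assoc C \<one> (\<one> \<otimes> x) y) \<cdot> (assoc C \<one> \<one> x \<boxtimes> Ident C y)"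
    by (simp del: tensor_Comp tensor_Comp_extend)
  then have "(Ident C \<one> \<boxtimes> (lunit C (x \<otimes> y) \<cdot> assoc C \<one> x y)) \<cdot> assoc C \<one> (\<one> \<otimes> x) y
    = (Ident C \<one> \<boxtimes> (lunit C x \<boxtimes> Ident C y)) \<cdot> assoc C \<one> (\<one> \<otimes> x) y"
    by (rule iso_cancel_right[OF iso]) simp_all
  then show "Ident C \<one> \<boxtimes> (lunit C (x \<otimes> y) \<cdot> assoc C \<one> x y) = Ident C \<one> \<boxtimes> (lunit C x \<boxtimes> Ident C y)"
    by (rule iso_cancel_right[rotated]) simp_all
qed simp_all

text \<open>The mirror image of the argument for the left unitor: tensor with the unit object on the
  right, postcompose with an associator, and compare by triangle, pentagon, triangle.\<close>

lemma runit_tensor: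
  assumes [simp]: "x \<in> Obj C" "y \<in> Obj C"
  shows "(Ident C x \<boxtimes> runit C y) \<cdot> assoc C x y \<one> = runit C (x \<otimes> y)"
proof (rule tensor_unit_faithful)
  have "assoc C x y \<one> \<cdot> (((Ident C x \<boxtimes> runit C y) \<cdot> assoc C x y \<one>) \<boxtimes> Ident C \<one>)
    = assoc C x y \<one> \<cdot> (((Ident C x \<boxtimes> runit C y) \<boxtimes> Ident C \<one>) \<cdot> (assoc C x y \<one> \<boxtimes> Ident C \<one>))"
    by simp
  also have "\<dots> = (Ident C x \<boxtimes> (runit C y \<boxtimes> Ident C \<one>)) \<cdot> (assoc C x (y \<otimes> \<one>) \<one> \<cdot> (assoc C x y \<one> \<boxtimes> Ident C \<one>))"
    using Comp_extend[OF assoc_naturality[of "Ident C x" "runit C y" "Ident C \<one>"]]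
    by (simp del: tensor_Comp tensor_Comp_extend)
  also have "\<dots> = (Ident C x \<boxtimes> (Ident C y \<boxtimes> lunit C \<one>)) \<cdot> ((Ident C x \<boxtimes> assoc C y \<one> \<one>)
      \<cdot> (assoc C x (y \<otimes> \<one>) \<one> \<cdot> (assoc C x y \<one> \<boxtimes> Ident C \<one>)))"
    by (simp add: triangle)
  also have "\<dots> = (Ident C x \<boxtimes> (Ident C y \<boxtimes> lunit C \<one>)) \<cdot> (assoc C x y (\<one> \<otimes> \<one>) \<cdot> assoc C (x \<otimes> y) \<one> \<one>)"
    by (simp only: pentagon' assms unit_ob_Obj)
  also have "\<dots> = assoc C x y \<one> \<cdot> ((Ident C (x \<otimes> y) \<boxtimes> lunit C \<one>) \<cdot> assoc C (x \<otimes> y) \<one> \<one>)"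
    using Comp_extend[OF assoc_naturality[of "Ident C x" "Ident C y" "lunit C \<one>"]] by simp
  also have "\<dots> = assoc C x y \<one> \<cdot> (runit C (x \<otimes> y) \<boxtimes> Ident C \<one>)"
    by (simp add: triangle)
  finally show "((Ident C x \<boxtimes> runit C y) \<cdot> assoc C x y \<one>) \<boxtimes> Ident C \<one> = runit C (x \<otimes> y) \<boxtimes> Ident C \<one>"
    by (rule iso_cancel_left[rotated]) simp_all
qed simp_all

text \<open>Naturality of the left unitor at \<open>lunit C \<one>\<close> gives \<open>Ident C
  \<one> \<boxtimes> lunit C \<one> = lunit C (\<one> \<otimes> \<one>)\<close>. Composing with the
  associator, the triangle makes the left side
  \<open>runit C \<one> \<boxtimes> Ident C \<one>\<close> and \<open>lunit_tensor\<close> makes the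
  right side \<open>lunit C \<one> \<boxtimes> Ident C \<one>\<close>.\<close>

lemma lunit_unit: "lunit C \<one> = runit C \<one>"
proof (rule tensor_unit_faithful)
  have "Ident C \<one> \<boxtimes> lunit C \<one> = lunit C (\<one> \<otimes> \<one>)"
    using lunit_naturality[of "lunit C \<one>"]
    by - (rule iso_cancel_left[of "lunit C \<one>"], simp_all)
  then show "lunit C \<one> \<boxtimes> Ident C \<one> = runit C \<one> \<boxtimes> Ident C \<one>"
    using triangle[of \<one> \<one>] lunit_tensor[of \<one> \<one>] by simp
qed simp_all

end


section \<open>Dual pairs and strong monoidal functors\<close>

context monoidal_category
begin

lemma lunit_inv_tensor:
  assumes [simp]: "x \<in> Obj C" "y \<in> Obj C"
  shows "iso_inv C (lunit C (x \<otimes> y)) = assoc C \<one> x y \<cdot> (iso_inv C (lunit C x) \<boxtimes> Ident C y)"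
  by (rule iso_cancel_left[of "lunit C (x \<otimes> y)"])
    (simp_all add: Comp_extend[OF lunit_tensor])

lemma runit_inv_tensor:
  assumes [simp]: "x \<in> Obj C" "y \<in> Obj C"
  shows "assoc C x y \<one> \<cdot> iso_inv C (runit C (x \<otimes> y)) = Ident C x \<boxtimes> iso_inv C (runit C y)"
proof (rule iso_cancel_left[of "Ident C x \<boxtimes> runit C y"])
  show "(Ident C x \<boxtimes> runit C y) \<cdot> (assoc C x y \<one> \<cdot> iso_inv C (runit C (x \<otimes> y)))
    = (Ident C x \<boxtimes> runit C y) \<cdot> (Ident C x \<boxtimes> iso_inv C (runit C y))"
    by (simp add: Comp_extend[OF runit_tensor])
qed (simp_all add: is_iso_tensor is_iso_Ident)

lemma pentagon_inv_right:
  assumes [simp]: "w \<in> Obj C" "x \<in> Obj C" "y \<in> Obj C" "z \<in> Obj C"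
  shows "(Ident C w \<boxtimes> iso_inv C (assoc C x y z)) \<cdot> (assoc C w x (y \<otimes> z) \<cdot> assoc C (w \<otimes> x) y z)
    = assoc C w (x \<otimes> y) z \<cdot> (assoc C w x y \<boxtimes> Ident C z)"
  by (simp add: pentagon')

text \<open>For a pairing \<open>e\<close> of \<open>x\<close> with \<open>a\<close> and a copairing
  \<open>c\<close> of \<open>a\<close> with \<open>y\<close>, this joins the two strands
  \<open>a\<close> into a morphism from \<open>x\<close> to \<open>y\<close>. The second snake
  composite and the canonical map \<open>\<phi>\<close> are both of this shape.\<close>

definition zigzag :: "'o \<Rightarrow> 'o \<Rightarrow> 'o \<Rightarrow> 'm \<Rightarrow> 'm \<Rightarrow> 'm" where
  "zigzag x a y e c = lunit C y \<cdot> ((e \<boxtimes> Ident C y) \<cdot> (iso_inv C (assoc C x a y)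
     \<cdot> ((Ident C x \<boxtimes> c) \<cdot> iso_inv C (runit C x))))"

lemma zigzag_simps [simp]:
  assumes "x \<in> Obj C" "a \<in> Obj C" "y \<in> Obj C" "e \<in> Mor C" "Dom C e = x \<otimes> a" "Cod C e = \<one>"
    "c \<in> Mor C" "Dom C c = \<one>" "Cod C c = a \<otimes> y"
  shows "zigzag x a y e c \<in> Mor C" "Dom C (zigzag x a y e c) = x" "Cod C (zigzag x a y e c) = y"
  using assms by (simp_all add: zigzag_def)

end

text \<open>A duality between two single objects, with \<open>b\<close> the left dual of
  \<open>a\<close> and no functor involved, so that it also covers \<open>U d\<close> and the image
  under \<open>U\<close> of the dual of \<open>d\<close>. The unit isomorphisms of the snake
  relations are moved to the right-hand sides, which avoids inverse unitors.\<close>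

locale dual_pair = monoidal_category C
  for C :: "('o, 'm, 'z) monoidal_category_scheme" (structure)
    and a b :: 'o and e c :: 'm +
  assumes objects [simp]: "a \<in> Obj C" "b \<in> Obj C"
    and e_simps [simp]: "e \<in> Mor C" "Dom C e = b \<otimes> a" "Cod C e = \<one>"
    and c_simps [simp]: "c \<in> Mor C" "Dom C c = \<one>" "Cod C c = a \<otimes> b"
    and snake_a: "runit C a \<cdot> ((Ident C a \<boxtimes> e) \<cdot> (assoc C a b a \<cdot> (c \<boxtimes> Ident C a))) = lunit C a"
    and snake_b: "lunit C b \<cdot> ((e \<boxtimes> Ident C b) \<cdot> (iso_inv C (assoc C b a b) \<cdot> (Ident C b \<boxtimes> c))) = runit C b"
begin

text \<open>Slide \<open>f\<close> past the associator and past \<open>c\<close>; what remains on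
  the left is the second snake composite, and naturality of the right unitor finishes.\<close>

lemma zigzag_ev:
  assumes f [simp]: "f \<in> Mor C" "Cod C f = b"
  shows "zigzag (Dom C f) a b (e \<cdot> (f \<boxtimes> Ident C a)) c = f"
proof -
  let ?x = "Dom C f"
  have "zigzag ?x a b (e \<cdot> (f \<boxtimes> Ident C a)) c
    = lunit C b \<cdot> ((e \<boxtimes> Ident C b) \<cdot> (((f \<boxtimes> Ident C a) \<boxtimes> Ident C b) \<cdot> (iso_inv C (assoc C ?x a b)
      \<cdot> ((Ident C ?x \<boxtimes> c) \<cdot> iso_inv C (runit C ?x)))))"
    by (simp add: zigzag_def)
  also have "\<dots> = lunit C b \<cdot> ((e \<boxtimes> Ident C b) \<cdot> (iso_inv C (assoc C b a b)
      \<cdot> ((f \<boxtimes> Ident C (a \<otimes> b)) \<cdot> ((Ident C ?x \<boxtimes> c) \<cdot> iso_inv C (runit C ?x)))))"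
    using Comp_extend[OF assoc_inv_naturality[of f "Ident C a" "Ident C b"]]
    by (simp del: tensor_Comp tensor_Comp_extend)
  also have "\<dots> = lunit C b \<cdot> ((e \<boxtimes> Ident C b) \<cdot> (iso_inv C (assoc C b a b)
      \<cdot> ((Ident C b \<boxtimes> c) \<cdot> ((f \<boxtimes> Ident C \<one>) \<cdot> iso_inv C (runit C ?x)))))"
    by simp
  also have "\<dots> = runit C b \<cdot> ((f \<boxtimes> Ident C \<one>) \<cdot> iso_inv C (runit C ?x))"
    by (simp add: snake_b[symmetric] del: tensor_Comp tensor_Comp_extend)
  also have "\<dots> = f"
    using Comp_extend[OF runit_naturality[of f]] by simp
  finally show ?thesis .
qed

text \<open>Both morphisms are the zigzag of the same pairing. Identities between morphisms into a
  dual are proved below by pairing them with \<open>a\<close>.\<close>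

lemma ev_faithful:
  assumes "e \<cdot> (f \<boxtimes> Ident C a) = e \<cdot> (g \<boxtimes> Ident C a)"
    "f \<in> Mor C" "g \<in> Mor C" "Dom C f = Dom C g" "Cod C f = b" "Cod C g = b"
  shows "f = g"
  using zigzag_ev[of f] zigzag_ev[of g] assms by metis

text \<open>With \<open>zigzag_ev\<close> this makes \<open>zigzag\<close> inverse to
  \<open>f \<mapsto> e \<cdot> (f \<boxtimes> Ident C a)\<close>: every pairing \<open>h\<close> has
  a transpose. The proof moves \<open>h\<close> to the outside until the first snake composite,
  tensored with \<open>x\<close>, is left.\<close>

lemma ev_zigzag:
  assumes [simp]: "x \<in> Obj C" "h \<in> Mor C" "Dom C h = x \<otimes> a" "Cod C h = \<one>"
  shows "e \<cdot> (zigzag x a b h c \<boxtimes> Ident C a) = h"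
proof -
  let ?I = "Ident C"
  have "e \<cdot> (zigzag x a b h c \<boxtimes> ?I a) = e \<cdot> ((lunit C b \<boxtimes> ?I a) \<cdot> (((h \<boxtimes> ?I b) \<boxtimes> ?I a)
      \<cdot> ((iso_inv C (assoc C x a b) \<boxtimes> ?I a) \<cdot> (((?I x \<boxtimes> c) \<boxtimes> ?I a) \<cdot> (iso_inv C (runit C x) \<boxtimes> ?I a)))))"
    by (simp add: zigzag_def)
  also have "\<dots> = e \<cdot> (lunit C (b \<otimes> a) \<cdot> (assoc C \<one> b a \<cdot> (((h \<boxtimes> ?I b) \<boxtimes> ?I a)
      \<cdot> ((iso_inv C (assoc C x a b) \<boxtimes> ?I a) \<cdot> (((?I x \<boxtimes> c) \<boxtimes> ?I a) \<cdot> (iso_inv C (runit C x) \<boxtimes> ?I a))))))"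
    by (simp add: lunit_tensor[symmetric] del: tensor_Comp tensor_Comp_extend)
  \<comment> \<open>On the unit object both unitors agree. The left one is natural for
    \<open>e\<close>, and reading it as the right one lets \<open>h\<close> pass through it after
    \<open>e\<close> and \<open>h\<close> are interchanged.\<close>
  also have "\<dots> = runit C \<one> \<cdot> ((?I \<one> \<boxtimes> e) \<cdot> (assoc C \<one> b a \<cdot> (((h \<boxtimes> ?I b) \<boxtimes> ?I a)
      \<cdot> ((iso_inv C (assoc C x a b) \<boxtimes> ?I a) \<cdot> (((?I x \<boxtimes> c) \<boxtimes> ?I a) \<cdot> (iso_inv C (runit C x) \<boxtimes> ?I a))))))"
    using Comp_extend[OF lunit_naturality[of e]] lunit_unit by (simp del: tensor_Comp tensor_Comp_extend)
  also have "\<dots> = runit C \<one> \<cdot> ((?I \<one> \<boxtimes> e) \<cdot> ((h \<boxtimes> ?I (b \<otimes> a)) \<cdot> (assoc C (x \<otimes> a) b a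
      \<cdot> ((iso_inv C (assoc C x a b) \<boxtimes> ?I a) \<cdot> (((?I x \<boxtimes> c) \<boxtimes> ?I a) \<cdot> (iso_inv C (runit C x) \<boxtimes> ?I a))))))"
    using Comp_extend[OF assoc_naturality[of h "?I b" "?I a"]] by (simp del: tensor_Comp tensor_Comp_extend)
  also have "\<dots> = runit C \<one> \<cdot> ((h \<boxtimes> ?I \<one>) \<cdot> ((?I (x \<otimes> a) \<boxtimes> e) \<cdot> (assoc C (x \<otimes> a) b a
      \<cdot> ((iso_inv C (assoc C x a b) \<boxtimes> ?I a) \<cdot> (((?I x \<boxtimes> c) \<boxtimes> ?I a) \<cdot> (iso_inv C (runit C x) \<boxtimes> ?I a))))))"
    by simp
  also have "\<dots> = h \<cdot> (runit C (x \<otimes> a) \<cdot> ((?I (x \<otimes> a) \<boxtimes> e) \<cdot> (assoc C (x \<otimes> a) b a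
      \<cdot> ((iso_inv C (assoc C x a b) \<boxtimes> ?I a) \<cdot> (((?I x \<boxtimes> c) \<boxtimes> ?I a) \<cdot> (iso_inv C (runit C x) \<boxtimes> ?I a))))))"
    using Comp_extend[OF runit_naturality[of h]] by (simp del: tensor_Comp tensor_Comp_extend)
  also have "\<dots> = h \<cdot> ((?I x \<boxtimes> runit C a) \<cdot> ((?I x \<boxtimes> (?I a \<boxtimes> e)) \<cdot> (assoc C x a (b \<otimes> a) \<cdot> (assoc C (x \<otimes> a) b a
      \<cdot> ((iso_inv C (assoc C x a b) \<boxtimes> ?I a) \<cdot> (((?I x \<boxtimes> c) \<boxtimes> ?I a) \<cdot> (iso_inv C (runit C x) \<boxtimes> ?I a)))))))"
    using Comp_extend[OF assoc_naturality[of "?I x" "?I a" e]]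
    by (simp add: runit_tensor[symmetric] del: tensor_Comp tensor_Comp_extend)
  also have "\<dots> = h \<cdot> ((?I x \<boxtimes> runit C a) \<cdot> ((?I x \<boxtimes> (?I a \<boxtimes> e)) \<cdot> ((?I x \<boxtimes> assoc C a b a)
      \<cdot> (assoc C x (a \<otimes> b) a \<cdot> (((?I x \<boxtimes> c) \<boxtimes> ?I a) \<cdot> (iso_inv C (runit C x) \<boxtimes> ?I a))))))"
  proof -
    \<comment> \<open>The pentagon with its last associator cancelled, for an arbitrary tail
      \<open>k\<close>. Afterwards only one associator around \<open>c\<close> acts outside
      \<open>x\<close>, and it moves past \<open>c\<close>.\<close>
    have "assoc C x a (b \<otimes> a) \<cdot> (assoc C (x \<otimes> a) b a \<cdot> ((iso_inv C (assoc C x a b) \<boxtimes> ?I a) \<cdot> k))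
      = (?I x \<boxtimes> assoc C a b a) \<cdot> (assoc C x (a \<otimes> b) a \<cdot> k)"
      if "k \<in> Mor C" "Cod C k = (x \<otimes> (a \<otimes> b)) \<otimes> a" for k
      using that by (simp add: Comp_extend[OF pentagon'])
    then show ?thesis by (simp del: tensor_Comp tensor_Comp_extend)
  qed
  also have "\<dots> = h \<cdot> ((?I x \<boxtimes> runit C a) \<cdot> ((?I x \<boxtimes> (?I a \<boxtimes> e)) \<cdot> ((?I x \<boxtimes> assoc C a b a)
      \<cdot> ((?I x \<boxtimes> (c \<boxtimes> ?I a)) \<cdot> (assoc C x \<one> a \<cdot> (iso_inv C (runit C x) \<boxtimes> ?I a))))))"
    using Comp_extend[OF assoc_naturality[of "?I x" c "?I a"]] by (simp del: tensor_Comp tensor_Comp_extend)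
  also have "\<dots> = h \<cdot> ((?I x \<boxtimes> lunit C a) \<cdot> (assoc C x \<one> a \<cdot> (iso_inv C (runit C x) \<boxtimes> ?I a)))"
    by (simp add: snake_a)
  also have "\<dots> = h"
    by (simp add: Comp_extend[OF triangle])
  finally show ?thesis .
qed

text \<open>The counterpart for copairings: here \<open>k\<close> is moved to the inner end, and the
  first snake composite, tensored with \<open>y\<close>, remains in front of it.\<close>

lemma coev_zigzag:
  assumes [simp]: "y \<in> Obj C" "k \<in> Mor C" "Dom C k = \<one>" "Cod C k = a \<otimes> y"
  shows "(Ident C a \<boxtimes> zigzag b a y e k) \<cdot> c = k"
proof -
  let ?I = "Ident C"
  have "(?I a \<boxtimes> zigzag b a y e k) \<cdot> c = (?I a \<boxtimes> lunit C y) \<cdot> ((?I a \<boxtimes> (e \<boxtimes> ?I y))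
      \<cdot> ((?I a \<boxtimes> iso_inv C (assoc C b a y)) \<cdot> ((?I a \<boxtimes> (?I b \<boxtimes> k)) \<cdot> ((?I a \<boxtimes> iso_inv C (runit C b)) \<cdot> c))))"
    by (simp add: zigzag_def)
  also have "\<dots> = (?I a \<boxtimes> lunit C y) \<cdot> ((?I a \<boxtimes> (e \<boxtimes> ?I y)) \<cdot> ((?I a \<boxtimes> iso_inv C (assoc C b a y))
      \<cdot> ((?I a \<boxtimes> (?I b \<boxtimes> k)) \<cdot> (assoc C a b \<one> \<cdot> (iso_inv C (runit C (a \<otimes> b)) \<cdot> c)))))"
    by (simp add: runit_inv_tensor[symmetric] del: tensor_Comp tensor_Comp_extend)
  also have "\<dots> = (?I a \<boxtimes> lunit C y) \<cdot> ((?I a \<boxtimes> (e \<boxtimes> ?I y)) \<cdot> ((?I a \<boxtimes> iso_inv C (assoc C b a y))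
      \<cdot> (assoc C a b (a \<otimes> y) \<cdot> ((?I (a \<otimes> b) \<boxtimes> k) \<cdot> ((c \<boxtimes> ?I \<one>) \<cdot> iso_inv C (runit C \<one>))))))"
    using Comp_extend[OF assoc_naturality[of "?I a" "?I b" k]] runit_inv_naturality[of c]
    by (simp del: tensor_Comp tensor_Comp_extend)
  also have "\<dots> = (?I a \<boxtimes> lunit C y) \<cdot> ((?I a \<boxtimes> (e \<boxtimes> ?I y)) \<cdot> ((?I a \<boxtimes> iso_inv C (assoc C b a y))
      \<cdot> (assoc C a b (a \<otimes> y) \<cdot> ((c \<boxtimes> ?I (a \<otimes> y)) \<cdot> ((?I \<one> \<boxtimes> k) \<cdot> iso_inv C (lunit C \<one>))))))"
    by (simp add: lunit_unit)
  \<comment> \<open>The morphisms \<open>c\<close> and \<open>k\<close> act on different factors and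
    are interchanged; the unitors agree on the unit object, so the left one can now be carried past
    \<open>k\<close>.\<close>
  also have "\<dots> = (?I a \<boxtimes> lunit C y) \<cdot> ((?I a \<boxtimes> (e \<boxtimes> ?I y)) \<cdot> ((?I a \<boxtimes> iso_inv C (assoc C b a y))
      \<cdot> (assoc C a b (a \<otimes> y) \<cdot> ((c \<boxtimes> ?I (a \<otimes> y)) \<cdot> (assoc C \<one> a y \<cdot> ((iso_inv C (lunit C a) \<boxtimes> ?I y) \<cdot> k))))))"
    using lunit_inv_naturality[of k] by (simp add: lunit_inv_tensor del: tensor_Comp tensor_Comp_extend)
  also have "\<dots> = (?I a \<boxtimes> lunit C y) \<cdot> ((?I a \<boxtimes> (e \<boxtimes> ?I y)) \<cdot> ((?I a \<boxtimes> iso_inv C (assoc C b a y))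
      \<cdot> (assoc C a b (a \<otimes> y) \<cdot> (assoc C (a \<otimes> b) a y \<cdot> (((c \<boxtimes> ?I a) \<boxtimes> ?I y) \<cdot> ((iso_inv C (lunit C a) \<boxtimes> ?I y) \<cdot> k))))))"
    using Comp_extend[OF assoc_naturality[of c "?I a" "?I y"]] by (simp del: tensor_Comp tensor_Comp_extend)
  also have "\<dots> = (?I a \<boxtimes> lunit C y) \<cdot> ((?I a \<boxtimes> (e \<boxtimes> ?I y)) \<cdot> (assoc C a (b \<otimes> a) y
      \<cdot> ((assoc C a b a \<boxtimes> ?I y) \<cdot> (((c \<boxtimes> ?I a) \<boxtimes> ?I y) \<cdot> ((iso_inv C (lunit C a) \<boxtimes> ?I y) \<cdot> k)))))"
    by (simp add: Comp_extend3[OF pentagon_inv_right] del: tensor_Comp tensor_Comp_extend)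
  also have "\<dots> = (?I a \<boxtimes> lunit C y) \<cdot> (assoc C a \<one> y \<cdot> (((?I a \<boxtimes> e) \<boxtimes> ?I y)
      \<cdot> ((assoc C a b a \<boxtimes> ?I y) \<cdot> (((c \<boxtimes> ?I a) \<boxtimes> ?I y) \<cdot> ((iso_inv C (lunit C a) \<boxtimes> ?I y) \<cdot> k)))))"
    using Comp_extend[OF assoc_naturality[of "?I a" e "?I y"]] by (simp del: tensor_Comp tensor_Comp_extend)
  also have "\<dots> = ((runit C a \<cdot> ((?I a \<boxtimes> e) \<cdot> (assoc C a b a \<cdot> (c \<boxtimes> ?I a)))) \<boxtimes> ?I y) \<cdot> ((iso_inv C (lunit C a) \<boxtimes> ?I y) \<cdot> k)"
    by (simp add: Comp_extend[OF triangle])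
  also have "\<dots> = k"
    by (simp only: snake_a) simp
  finally show ?thesis .
qed

end

section \<open>Dual pairs from a left duality\<close>

context left_duality
begin

lemma ev_simps [simp]:
  assumes "a \<in> Obj C"
  shows "ev L a \<in> Mor C" "Dom C (ev L a) = ob (dual L) a \<otimes> a" "Cod C (ev L a) = \<one>"
  using ev_in[OF assms] by (auto simp: Hom_iff)

lemma coev_simps [simp]:
  assumes "a \<in> Obj C"
  shows "coev L a \<in> Mor C" "Dom C (coev L a) = \<one>" "Cod C (coev L a) = a \<otimes> ob (dual L) a"
  using coev_in[OF assms] by (auto simp: Hom_iff)

lemma dual_ob_Obj [simp]: "a \<in> Obj C \<Longrightarrow> ob (dual L) a \<in> Obj C"
  using dual.ob_Obj by simp

lemma dual_simps [simp]:
  assumes "f \<in> Mor C"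
  shows "mor (dual L) f \<in> Mor C" "Dom C (mor (dual L) f) = ob (dual L) (Cod C f)"
    "Cod C (mor (dual L) f) = ob (dual L) (Dom C f)"
  using dual.mor_simps assms by simp_all

lemma dual_Ident [simp]: "a \<in> Obj C \<Longrightarrow> mor (dual L) (Ident C a) = Ident C (ob (dual L) a)"
  using dual.mor_Ident' by simp

lemma dual_Comp [simp]:
  "g \<in> Mor C \<Longrightarrow> f \<in> Mor C \<Longrightarrow> Dom C g = Cod C f \<Longrightarrow>
    mor (dual L) (g \<cdot> f) = mor (dual L) f \<cdot> mor (dual L) g"
  using dual.mor_Comp'[of f g] by simp

lemma ev_dinaturality:
  "f \<in> Mor C \<Longrightarrow> ev L (Dom C f) \<cdot> (mor (dual L) f \<boxtimes> Ident C (Dom C f))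
    = ev L (Cod C f) \<cdot> (Ident C (ob (dual L) (Cod C f)) \<boxtimes> f)"
  by (rule ev_dinatural) (auto simp: Hom_iff)

lemma coev_dinaturality:
  "f \<in> Mor C \<Longrightarrow> (f \<boxtimes> Ident C (ob (dual L) (Dom C f))) \<cdot> coev L (Dom C f)
    = (Ident C (Cod C f) \<boxtimes> mor (dual L) f) \<cdot> coev L (Cod C f)"
  by (rule coev_dinatural) (auto simp: Hom_iff)

text \<open>The two snake relations of the duality, with the inverse unitors at their right ends
  moved across the equations.\<close>

lemma dual_pair_ev_coev:
  assumes [simp]: "a \<in> Obj C"
  shows "dual_pair C a (ob (dual L) a) (ev L a) (coev L a)"
proof
  let ?b = "ob (dual L) a"
  have "(runit C a \<cdot> ((Ident C a \<boxtimes> ev L a) \<cdot> (assoc C a ?b a \<cdot> (coev L a \<boxtimes> Ident C a)))) \<cdot> iso_inv C (lunit C a)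
    = Ident C a"
    using snake_ob[OF assms] by (simp del: tensor_Comp tensor_Comp_extend)
  then show "runit C a \<cdot> ((Ident C a \<boxtimes> ev L a) \<cdot> (assoc C a ?b a \<cdot> (coev L a \<boxtimes> Ident C a))) = lunit C a"
    by (subst (asm) Comp_iso_inv_eq_iff) simp_all
  have "(lunit C ?b \<cdot> ((ev L a \<boxtimes> Ident C ?b) \<cdot> (iso_inv C (assoc C ?b a ?b) \<cdot> (Ident C ?b \<boxtimes> coev L a)))) \<cdot> iso_inv C (runit C ?b)
    = Ident C ?b"
    using snake_dual[OF assms] by (simp del: tensor_Comp tensor_Comp_extend)
  then show "lunit C ?b \<cdot> ((ev L a \<boxtimes> Ident C ?b) \<cdot> (iso_inv C (assoc C ?b a ?b) \<cdot> (Ident C ?b \<boxtimes> coev L a))) = runit C ?b"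
    by (subst (asm) Comp_iso_inv_eq_iff) simp_all
qed simp_all

end

section \<open>Strong monoidal functors preserve dual pairs\<close>

context strong_monoidal_functor
begin

lemma s2_simps [simp]:
  assumes "d \<in> Obj D" "d' \<in> Obj D"
  shows "s2 d d' \<in> Mor C" "Dom C (s2 d d') = ob U d \<otimes>\<^bsub>C\<^esub> ob U d'" "Cod C (s2 d d') = ob U (d \<otimes>\<^bsub>D\<^esub> d')"
    "is_iso C (s2 d d')"
  using s2_in[OF assms] s2_iso[OF assms] by (auto simp: Hom_iff)

lemma s0_simps [simp]:
  "s0 \<in> Mor C" "Dom C s0 = \<one>\<^bsub>C\<^esub>" "Cod C s0 = ob U \<one>\<^bsub>D\<^esub>" "is_iso C s0"
  using s0_in s0_iso by (auto simp: Hom_iff)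

lemma s2_naturality:
  assumes "f \<in> Mor D" "g \<in> Mor D"
  shows "s2 (Cod D f) (Cod D g) \<cdot>\<^bsub>C\<^esub> (mor U f \<boxtimes>\<^bsub>C\<^esub> mor U g) = mor U (f \<boxtimes>\<^bsub>D\<^esub> g) \<cdot>\<^bsub>C\<^esub> s2 (Dom D f) (Dom D g)"
  using assms by (intro s2_natural) (auto simp: Hom_iff)

lemma s2_inv_naturality:
  assumes "f \<in> Mor D" "g \<in> Mor D"
  shows "iso_inv C (s2 (Cod D f) (Cod D g)) \<cdot>\<^bsub>C\<^esub> mor U (f \<boxtimes>\<^bsub>D\<^esub> g)
    = (mor U f \<boxtimes>\<^bsub>C\<^esub> mor U g) \<cdot>\<^bsub>C\<^esub> iso_inv C (s2 (Dom D f) (Dom D g))"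
  using assms by (simp add: C.iso_inv_Comp_eq_iff C.Comp_extend[OF s2_naturality])

lemma s2_assoc':
  assumes [simp]: "d \<in> Obj D" "d' \<in> Obj D" "d'' \<in> Obj D"
  shows "mor U (assoc D d d' d'') \<cdot>\<^bsub>C\<^esub> (s2 (d \<otimes>\<^bsub>D\<^esub> d') d'' \<cdot>\<^bsub>C\<^esub> (s2 d d' \<boxtimes>\<^bsub>C\<^esub> Ident C (ob U d'')))
        = s2 d (d' \<otimes>\<^bsub>D\<^esub> d'') \<cdot>\<^bsub>C\<^esub> ((Ident C (ob U d) \<boxtimes>\<^bsub>C\<^esub> s2 d' d'')
            \<cdot>\<^bsub>C\<^esub> assoc C (ob U d) (ob U d') (ob U d''))"
  using s2_assoc[OF assms] by simp

text \<open>The associativity law with both associators inverted, the form that occurs in the second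
  snake relation.\<close>

lemma s2_assoc_inv:
  assumes [simp]: "d \<in> Obj D" "d' \<in> Obj D" "d'' \<in> Obj D"
  shows "s2 (d \<otimes>\<^bsub>D\<^esub> d') d'' \<cdot>\<^bsub>C\<^esub> ((s2 d d' \<boxtimes>\<^bsub>C\<^esub> Ident C (ob U d''))
            \<cdot>\<^bsub>C\<^esub> iso_inv C (assoc C (ob U d) (ob U d') (ob U d'')))
    = mor U (iso_inv D (assoc D d d' d'')) \<cdot>\<^bsub>C\<^esub> (s2 d (d' \<otimes>\<^bsub>D\<^esub> d'') \<cdot>\<^bsub>C\<^esub> (Ident C (ob U d) \<boxtimes>\<^bsub>C\<^esub> s2 d' d''))"
proof (rule C.iso_cancel_left[of "mor U (assoc D d d' d'')"])
  show "mor U (assoc D d d' d'') \<cdot>\<^bsub>C\<^esub> (s2 (d \<otimes>\<^bsub>D\<^esub> d') d'' \<cdot>\<^bsub>C\<^esub> ((s2 d d' \<boxtimes>\<^bsub>C\<^esub> Ident C (ob U d''))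
            \<cdot>\<^bsub>C\<^esub> iso_inv C (assoc C (ob U d) (ob U d') (ob U d''))))
    = mor U (assoc D d d' d'') \<cdot>\<^bsub>C\<^esub> (mor U (iso_inv D (assoc D d d' d'')) \<cdot>\<^bsub>C\<^esub> (s2 d (d' \<otimes>\<^bsub>D\<^esub> d'') \<cdot>\<^bsub>C\<^esub> (Ident C (ob U d) \<boxtimes>\<^bsub>C\<^esub> s2 d' d'')))"
    by (simp add: C.Comp_extend3[OF s2_assoc'] is_iso_mor flip: is_iso_mor(2))
qed (simp_all add: is_iso_mor)

text \<open>The associativity law with all \<open>s2\<close> inverted, the form that coassociativity
  of the opmonoidal structure needs. It follows by precomposing with the two comparison maps, which
  are invertible.\<close>

lemma s2_inv_assoc:
  assumes [simp]: "d \<in> Obj D" "d' \<in> Obj D" "d'' \<in> Obj D"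
  shows "assoc C (ob U d) (ob U d') (ob U d'') \<cdot>\<^bsub>C\<^esub> ((iso_inv C (s2 d d') \<boxtimes>\<^bsub>C\<^esub> Ident C (ob U d''))
            \<cdot>\<^bsub>C\<^esub> iso_inv C (s2 (d \<otimes>\<^bsub>D\<^esub> d') d''))
    = (Ident C (ob U d) \<boxtimes>\<^bsub>C\<^esub> iso_inv C (s2 d' d'')) \<cdot>\<^bsub>C\<^esub> (iso_inv C (s2 d (d' \<otimes>\<^bsub>D\<^esub> d'')) \<cdot>\<^bsub>C\<^esub> mor U (assoc D d d' d''))"
    (is "?l = ?r")
proof -
  have "(?l \<cdot>\<^bsub>C\<^esub> s2 (d \<otimes>\<^bsub>D\<^esub> d') d'') \<cdot>\<^bsub>C\<^esub> (s2 d d' \<boxtimes>\<^bsub>C\<^esub> Ident C (ob U d''))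
      = (?r \<cdot>\<^bsub>C\<^esub> s2 (d \<otimes>\<^bsub>D\<^esub> d') d'') \<cdot>\<^bsub>C\<^esub> (s2 d d' \<boxtimes>\<^bsub>C\<^esub> Ident C (ob U d''))"
    by (simp add: s2_assoc')
  then have "?l \<cdot>\<^bsub>C\<^esub> s2 (d \<otimes>\<^bsub>D\<^esub> d') d'' = ?r \<cdot>\<^bsub>C\<^esub> s2 (d \<otimes>\<^bsub>D\<^esub> d') d''"
    by (rule C.iso_cancel_right[rotated]) (simp_all add: C.is_iso_tensor C.is_iso_Ident)
  then show ?thesis
    by (rule C.iso_cancel_right[rotated]) simp_all
qed

lemma s2_lunit':
  "d \<in> Obj D \<Longrightarrow> mor U (lunit D d) \<cdot>\<^bsub>C\<^esub> (s2 \<one>\<^bsub>D\<^esub> d \<cdot>\<^bsub>C\<^esub> (s0 \<boxtimes>\<^bsub>C\<^esub> Ident C (ob U d))) = lunit C (ob U d)"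
  using s2_lunit[of d] by simp

lemma s2_runit':
  "d \<in> Obj D \<Longrightarrow> mor U (runit D d) \<cdot>\<^bsub>C\<^esub> (s2 d \<one>\<^bsub>D\<^esub> \<cdot>\<^bsub>C\<^esub> (Ident C (ob U d) \<boxtimes>\<^bsub>C\<^esub> s0)) = runit C (ob U d)"
  using s2_runit[of d] by simp

text \<open>The constraints of \<open>U\<close> carry each snake composite in \<open>C\<close> to
  the image under \<open>U\<close> of the corresponding one in \<open>D\<close>: the
  \<open>s2\<close> inside the pairing and the inverse \<open>s2\<close> inside the copairing meet
  across the associator and cancel.\<close>

lemma dual_pair_image:
  assumes "dual_pair D d d' e c"
  shows "dual_pair C (ob U d) (ob U d') (iso_inv C s0 \<cdot>\<^bsub>C\<^esub> (mor U e \<cdot>\<^bsub>C\<^esub> s2 d' d))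
    (iso_inv C (s2 d d') \<cdot>\<^bsub>C\<^esub> (mor U c \<cdot>\<^bsub>C\<^esub> s0))" (is "dual_pair C ?a ?b ?e ?c")
proof -
  interpret dual_pair D d d' e c by fact
  note [simp del] = C.tensor_Comp C.tensor_Comp_extend
  show ?thesis
  proof
    let ?A = "Ident C ?a" and ?B = "Ident C ?b"
    \<comment> \<open>Expanding the right unitor by the unit law of \<open>U\<close> produces an
      \<open>s0\<close> that cancels the inverse in \<open>?e\<close>. The remaining
      \<open>s2\<close> then pass the associator by \<open>s2_assoc'\<close> and cancel in
      \<open>?c\<close>.\<close>
    have "runit C ?a \<cdot>\<^bsub>C\<^esub> ((?A \<boxtimes>\<^bsub>C\<^esub> ?e) \<cdot>\<^bsub>C\<^esub> (assoc C ?a ?b ?a \<cdot>\<^bsub>C\<^esub> (?c \<boxtimes>\<^bsub>C\<^esub> ?A)))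
      = mor U (runit D d) \<cdot>\<^bsub>C\<^esub> (s2 d \<one>\<^bsub>D\<^esub> \<cdot>\<^bsub>C\<^esub> ((?A \<boxtimes>\<^bsub>C\<^esub> s0) \<cdot>\<^bsub>C\<^esub> ((?A \<boxtimes>\<^bsub>C\<^esub> ?e) \<cdot>\<^bsub>C\<^esub> (assoc C ?a ?b ?a \<cdot>\<^bsub>C\<^esub> (?c \<boxtimes>\<^bsub>C\<^esub> ?A)))))"
      by (simp flip: s2_runit')
    also have "\<dots> = mor U (runit D d) \<cdot>\<^bsub>C\<^esub> (s2 d \<one>\<^bsub>D\<^esub> \<cdot>\<^bsub>C\<^esub> ((?A \<boxtimes>\<^bsub>C\<^esub> mor U e)
        \<cdot>\<^bsub>C\<^esub> ((?A \<boxtimes>\<^bsub>C\<^esub> s2 d' d) \<cdot>\<^bsub>C\<^esub> (assoc C ?a ?b ?a \<cdot>\<^bsub>C\<^esub> (?c \<boxtimes>\<^bsub>C\<^esub> ?A)))))"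
      by (simp add: C.tensor_Comp C.tensor_Comp_extend)
    also have "\<dots> = mor U (runit D d) \<cdot>\<^bsub>C\<^esub> (mor U (Ident D d \<boxtimes>\<^bsub>D\<^esub> e)
        \<cdot>\<^bsub>C\<^esub> (s2 d (d' \<otimes>\<^bsub>D\<^esub> d) \<cdot>\<^bsub>C\<^esub> ((?A \<boxtimes>\<^bsub>C\<^esub> s2 d' d) \<cdot>\<^bsub>C\<^esub> (assoc C ?a ?b ?a \<cdot>\<^bsub>C\<^esub> (?c \<boxtimes>\<^bsub>C\<^esub> ?A)))))"
      using C.Comp_extend[OF s2_naturality[of "Ident D d" e]] by simp
    also have "\<dots> = mor U (runit D d) \<cdot>\<^bsub>C\<^esub> (mor U (Ident D d \<boxtimes>\<^bsub>D\<^esub> e) \<cdot>\<^bsub>C\<^esub> (mor U (assoc D d d' d)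
        \<cdot>\<^bsub>C\<^esub> (s2 (d \<otimes>\<^bsub>D\<^esub> d') d \<cdot>\<^bsub>C\<^esub> ((s2 d d' \<boxtimes>\<^bsub>C\<^esub> ?A) \<cdot>\<^bsub>C\<^esub> (?c \<boxtimes>\<^bsub>C\<^esub> ?A)))))"
      by (simp add: C.Comp_extend3[OF s2_assoc'])
    also have "\<dots> = mor U (runit D d) \<cdot>\<^bsub>C\<^esub> (mor U (Ident D d \<boxtimes>\<^bsub>D\<^esub> e) \<cdot>\<^bsub>C\<^esub> (mor U (assoc D d d' d)
        \<cdot>\<^bsub>C\<^esub> (s2 (d \<otimes>\<^bsub>D\<^esub> d') d \<cdot>\<^bsub>C\<^esub> ((mor U c \<boxtimes>\<^bsub>C\<^esub> ?A) \<cdot>\<^bsub>C\<^esub> (s0 \<boxtimes>\<^bsub>C\<^esub> ?A)))))"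
      by (simp add: C.tensor_Comp)
    also have "\<dots> = mor U (runit D d \<cdot>\<^bsub>D\<^esub> ((Ident D d \<boxtimes>\<^bsub>D\<^esub> e) \<cdot>\<^bsub>D\<^esub> (assoc D d d' d \<cdot>\<^bsub>D\<^esub> (c \<boxtimes>\<^bsub>D\<^esub> Ident D d))))
        \<cdot>\<^bsub>C\<^esub> (s2 \<one>\<^bsub>D\<^esub> d \<cdot>\<^bsub>C\<^esub> (s0 \<boxtimes>\<^bsub>C\<^esub> ?A))"
      using C.Comp_extend[OF s2_naturality[of c "Ident D d"]] by simp
    also have "\<dots> = lunit C ?a"
      by (simp only: snake_a s2_lunit' objects)
    finally show "runit C ?a \<cdot>\<^bsub>C\<^esub> ((?A \<boxtimes>\<^bsub>C\<^esub> ?e) \<cdot>\<^bsub>C\<^esub> (assoc C ?a ?b ?a \<cdot>\<^bsub>C\<^esub> (?c \<boxtimes>\<^bsub>C\<^esub> ?A))) = lunit C ?a" .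

    \<comment> \<open>The same with the left unitor and the inverted associativity law.\<close>
    have "lunit C ?b \<cdot>\<^bsub>C\<^esub> ((?e \<boxtimes>\<^bsub>C\<^esub> ?B) \<cdot>\<^bsub>C\<^esub> (iso_inv C (assoc C ?b ?a ?b) \<cdot>\<^bsub>C\<^esub> (?B \<boxtimes>\<^bsub>C\<^esub> ?c)))
      = mor U (lunit D d') \<cdot>\<^bsub>C\<^esub> (s2 \<one>\<^bsub>D\<^esub> d' \<cdot>\<^bsub>C\<^esub> ((s0 \<boxtimes>\<^bsub>C\<^esub> ?B) \<cdot>\<^bsub>C\<^esub> ((?e \<boxtimes>\<^bsub>C\<^esub> ?B)
        \<cdot>\<^bsub>C\<^esub> (iso_inv C (assoc C ?b ?a ?b) \<cdot>\<^bsub>C\<^esub> (?B \<boxtimes>\<^bsub>C\<^esub> ?c)))))"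
      by (simp flip: s2_lunit')
    also have "\<dots> = mor U (lunit D d') \<cdot>\<^bsub>C\<^esub> (s2 \<one>\<^bsub>D\<^esub> d' \<cdot>\<^bsub>C\<^esub> ((mor U e \<boxtimes>\<^bsub>C\<^esub> ?B) \<cdot>\<^bsub>C\<^esub> ((s2 d' d \<boxtimes>\<^bsub>C\<^esub> ?B)
        \<cdot>\<^bsub>C\<^esub> (iso_inv C (assoc C ?b ?a ?b) \<cdot>\<^bsub>C\<^esub> (?B \<boxtimes>\<^bsub>C\<^esub> ?c)))))"
      by (simp add: C.tensor_Comp C.tensor_Comp_extend)
    also have "\<dots> = mor U (lunit D d') \<cdot>\<^bsub>C\<^esub> (mor U (e \<boxtimes>\<^bsub>D\<^esub> Ident D d') \<cdot>\<^bsub>C\<^esub> (s2 (d' \<otimes>\<^bsub>D\<^esub> d) d' \<cdot>\<^bsub>C\<^esub> ((s2 d' d \<boxtimes>\<^bsub>C\<^esub> ?B)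
        \<cdot>\<^bsub>C\<^esub> (iso_inv C (assoc C ?b ?a ?b) \<cdot>\<^bsub>C\<^esub> (?B \<boxtimes>\<^bsub>C\<^esub> ?c)))))"
      using C.Comp_extend[OF s2_naturality[of e "Ident D d'"]] by simp
    also have "\<dots> = mor U (lunit D d') \<cdot>\<^bsub>C\<^esub> (mor U (e \<boxtimes>\<^bsub>D\<^esub> Ident D d') \<cdot>\<^bsub>C\<^esub> (mor U (iso_inv D (assoc D d' d d'))
        \<cdot>\<^bsub>C\<^esub> (s2 d' (d \<otimes>\<^bsub>D\<^esub> d') \<cdot>\<^bsub>C\<^esub> ((?B \<boxtimes>\<^bsub>C\<^esub> s2 d d') \<cdot>\<^bsub>C\<^esub> (?B \<boxtimes>\<^bsub>C\<^esub> ?c)))))"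
      by (simp add: C.Comp_extend3[OF s2_assoc_inv])
    also have "\<dots> = mor U (lunit D d') \<cdot>\<^bsub>C\<^esub> (mor U (e \<boxtimes>\<^bsub>D\<^esub> Ident D d') \<cdot>\<^bsub>C\<^esub> (mor U (iso_inv D (assoc D d' d d'))
        \<cdot>\<^bsub>C\<^esub> (s2 d' (d \<otimes>\<^bsub>D\<^esub> d') \<cdot>\<^bsub>C\<^esub> ((?B \<boxtimes>\<^bsub>C\<^esub> mor U c) \<cdot>\<^bsub>C\<^esub> (?B \<boxtimes>\<^bsub>C\<^esub> s0)))))"
      by (simp add: C.tensor_Comp)
    also have "\<dots> = mor U (lunit D d' \<cdot>\<^bsub>D\<^esub> ((e \<boxtimes>\<^bsub>D\<^esub> Ident D d') \<cdot>\<^bsub>D\<^esub> (iso_inv D (assoc D d' d d') \<cdot>\<^bsub>D\<^esub> (Ident D d' \<boxtimes>\<^bsub>D\<^esub> c))))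
        \<cdot>\<^bsub>C\<^esub> (s2 d' \<one>\<^bsub>D\<^esub> \<cdot>\<^bsub>C\<^esub> (?B \<boxtimes>\<^bsub>C\<^esub> s0))"
      using C.Comp_extend[OF s2_naturality[of "Ident D d'" c]] by simp
    also have "\<dots> = runit C ?b"
      by (simp only: snake_b s2_runit' objects)
    finally show "lunit C ?b \<cdot>\<^bsub>C\<^esub> ((?e \<boxtimes>\<^bsub>C\<^esub> ?B) \<cdot>\<^bsub>C\<^esub> (iso_inv C (assoc C ?b ?a ?b) \<cdot>\<^bsub>C\<^esub> (?B \<boxtimes>\<^bsub>C\<^esub> ?c))) = runit C ?b" .
  qed simp_all
qed

end


section \<open>Adjunctions and the comparison of duals\<close>

context adjunction
begin

lemma unit_naturality: "f \<in> Mor C \<Longrightarrow> \<eta> (Cod C f) \<cdot>\<^bsub>C\<^esub> f = mor U (mor F f) \<cdot>\<^bsub>C\<^esub> \<eta> (Dom C f)"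
  using unit.naturality'[of f] by simp

lemma counit_naturality: "f \<in> Mor D \<Longrightarrow> \<epsilon> (Cod D f) \<cdot>\<^bsub>D\<^esub> mor F (mor U f) = f \<cdot>\<^bsub>D\<^esub> \<epsilon> (Dom D f)"
  using counit.naturality'[of f] by simp

text \<open>The image under \<open>U\<close> of the adjunct \<open>F x \<rightarrow> d\<close> of
  \<open>f\<close>; equivalently, the morphism of algebras for the monad \<open>U F\<close> out of
  the free algebra on \<open>x\<close> that restricts to \<open>f\<close> along the unit.\<close>

definition ext :: "'b \<Rightarrow> 'f \<Rightarrow> 'f" where
  "ext d f = mor U (\<epsilon> d) \<cdot>\<^bsub>C\<^esub> mor U (mor F f)"

lemma ext_simps [simp]:
  assumes "f \<in> Mor C" "Cod C f = ob U d" "d \<in> Obj D"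
  shows "ext d f \<in> Mor C" "Dom C (ext d f) = ob U (ob F (Dom C f))" "Cod C (ext d f) = ob U d"
  using assms by (simp_all add: ext_def)

lemma ext_eq_mor:
  assumes "f \<in> Mor C" "Cod C f = ob U d" "d \<in> Obj D"
  shows "ext d f = mor U (\<epsilon> d \<cdot>\<^bsub>D\<^esub> mor F f)"
  using assms by (simp add: ext_def)

text \<open>Naturality of the counit at \<open>g\<close>, mapped by \<open>U\<close>. Morphisms in
  the image of \<open>U\<close> can therefore be moved into and out of an extension.\<close>

lemma mor_ext:
  assumes "g \<in> Mor D" "f \<in> Mor C" "Cod C f = ob U (Dom D g)"
  shows "mor U g \<cdot>\<^bsub>C\<^esub> ext (Dom D g) f = ext (Cod D g) (mor U g \<cdot>\<^bsub>C\<^esub> f)"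
proof -
  have "mor U g \<cdot>\<^bsub>C\<^esub> ext (Dom D g) f = mor U (g \<cdot>\<^bsub>D\<^esub> (\<epsilon> (Dom D g) \<cdot>\<^bsub>D\<^esub> mor F f))"
    using assms by (simp add: ext_def)
  also have "\<dots> = mor U (\<epsilon> (Cod D g) \<cdot>\<^bsub>D\<^esub> (mor F (mor U g) \<cdot>\<^bsub>D\<^esub> mor F f))"
    using assms by (simp add: F.D.Comp_extend[OF counit_naturality] del: U.mor_Comp')
  also have "\<dots> = ext (Cod D g) (mor U g \<cdot>\<^bsub>C\<^esub> f)"
    using assms by (simp add: ext_def)
  finally show ?thesis .
qed

lemma ext_mor [simp]:
  assumes "f \<in> Mor C" "h \<in> Mor C" "Dom C f = Cod C h" "Cod C f = ob U d" "d \<in> Obj D"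
  shows "ext d f \<cdot>\<^bsub>C\<^esub> mor U (mor F h) = ext d (f \<cdot>\<^bsub>C\<^esub> h)"
  using assms by (simp add: ext_def)

text \<open>Naturality of the unit moves it past \<open>f\<close>, and a triangle identity removes
  it together with the counit.\<close>

lemma ext_unit:
  assumes "f \<in> Mor C" "Cod C f = ob U d" "d \<in> Obj D" "Dom C f = x"
  shows "ext d f \<cdot>\<^bsub>C\<^esub> \<eta> x = f"
proof -
  have "ext d f \<cdot>\<^bsub>C\<^esub> \<eta> x = mor U (\<epsilon> d) \<cdot>\<^bsub>C\<^esub> (\<eta> (Cod C f) \<cdot>\<^bsub>C\<^esub> f)"
    using unit_naturality[of f] assms by (auto simp: ext_def)
  also have "\<dots> = f"
    using assms by (simp add: F.C.Comp_extend[OF triangle_right])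
  finally show ?thesis .
qed

lemma ext_of_unit: "x \<in> Obj C \<Longrightarrow> ext (ob F x) (\<eta> x) = Ident C (ob U (ob F x))"
  using triangle_left[of x] by (simp add: ext_def flip: U.mor_Comp')

text \<open>The extension of \<open>\<eta> x\<close> is an identity by the other triangle. Values of
  \<open>U F\<close> on morphisms are thereby extensions too and can be compared with the
  others.\<close>

lemma ext_unit_Comp:
  assumes "f \<in> Mor C" "Cod C f = x"
  shows "ext (ob F x) (\<eta> x \<cdot>\<^bsub>C\<^esub> f) = mor U (mor F f)"
proof -
  have [simp]: "x \<in> Obj C"
    using assms by auto
  show ?thesis
    using ext_mor[of "\<eta> x" f "ob F x"] assms by (simp add: ext_of_unit del: ext_mor)
qed

text \<open>Naturality of the counit at the adjunct of \<open>f\<close>; this is compatibility of an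
  extension with the multiplication of the monad.\<close>

lemma ext_mult:
  assumes "f \<in> Mor C" "Cod C f = ob U d" "d \<in> Obj D" "Dom C f = x"
  shows "ext d f \<cdot>\<^bsub>C\<^esub> mor U (\<epsilon> (ob F x)) = ext d (ext d f)"
proof -
  have [simp]: "x \<in> Obj C"
    using assms by auto
  have "ext d f \<cdot>\<^bsub>C\<^esub> mor U (\<epsilon> (ob F x)) = mor U ((\<epsilon> d \<cdot>\<^bsub>D\<^esub> mor F f) \<cdot>\<^bsub>D\<^esub> \<epsilon> (ob F x))"
    using assms by (simp add: ext_def)
  also have "\<dots> = mor U (\<epsilon> d \<cdot>\<^bsub>D\<^esub> mor F (ext d f))"
    using counit_naturality[of "\<epsilon> d \<cdot>\<^bsub>D\<^esub> mor F f"] assms by (simp add: ext_eq_mor del: U.mor_Comp')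
  also have "\<dots> = ext d (ext d f)"
    using assms by (simp add: ext_def)
  finally show ?thesis .
qed

end

locale duality_adjunction = CL: left_duality C L + DM: left_duality D M +
    adjunction C D F U \<eta> \<epsilon> + strong_monoidal_functor D C U s2 s0
  for C :: "('a, 'f, 'y) monoidal_category_scheme" (structure)
    and D :: "('b, 'g, 'z) monoidal_category_scheme"
    and L :: "('a, 'f) duality_data"
    and M :: "('b, 'g) duality_data"
    and F :: "('a, 'f, 'b, 'g) functor_data"
    and U :: "('b, 'g, 'a, 'f) functor_data"
    and \<eta> :: "'a \<Rightarrow> 'f"
    and \<epsilon> :: "'b \<Rightarrow> 'g"
    and s2 :: "'b \<Rightarrow> 'b \<Rightarrow> 'f"
    and s0 :: 'f
begin

section \<open>The comparison isomorphism between the two duals of \<open>U d\<close>\<close>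

abbreviation evU :: "'b \<Rightarrow> 'f" where
  "evU d \<equiv> iso_inv C s0 \<cdot> (mor U (ev M d) \<cdot> s2 (ob (dual M) d) d)"

abbreviation coevU :: "'b \<Rightarrow> 'f" where
  "coevU d \<equiv> iso_inv C (s2 d (ob (dual M) d)) \<cdot> (mor U (coev M d) \<cdot> s0)"

abbreviation \<phi> :: "'b \<Rightarrow> 'f" where
  "\<phi> \<equiv> canonical_dual_iso C D L M U s2 s0"

text \<open>By interchange the three maps tensored with an identity in \<open>\<phi>\<close> merge
  into one, namely \<open>coevU d\<close>. The pairing thus comes from one dual of
  \<open>U d\<close> and the copairing from the other.\<close>

lemma \<phi>_eq_zigzag:
  "d \<in> Obj D \<Longrightarrow> \<phi> d = CL.zigzag (ob (dual L) (ob U d)) (ob U d) (ob U (ob (dual M) d)) (ev L (ob U d)) (coevU d)"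
  by (simp add: canonical_dual_iso_def Let_def CL.zigzag_def)

lemma dual_pair_evU: "d \<in> Obj D \<Longrightarrow> dual_pair C (ob U d) (ob U (ob (dual M) d)) (evU d) (coevU d)"
  by (intro dual_pair_image DM.dual_pair_ev_coev)

lemma \<phi>_simps [simp]:
  assumes "d \<in> Obj D"
  shows "\<phi> d \<in> Mor C" "Dom C (\<phi> d) = ob (dual L) (ob U d)" "Cod C (\<phi> d) = ob U (ob (dual M) d)"
  using assms by (simp_all add: \<phi>_eq_zigzag)

text \<open>Read in the dual pair formed by \<open>evU d\<close> and \<open>coevU d\<close>, the map
  \<open>\<phi> d\<close> is the transpose of the pairing \<open>ev L (ob U d)\<close>.\<close>

lemma evU_\<phi>:
  assumes [simp]: "d \<in> Obj D"
  shows "evU d \<cdot> (\<phi> d \<boxtimes> Ident C (ob U d)) = ev L (ob U d)"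
proof -
  interpret dual_pair C "ob U d" "ob U (ob (dual M) d)" "evU d" "coevU d"
    by (rule dual_pair_evU) fact
  show ?thesis
    unfolding \<phi>_eq_zigzag[OF assms] by (rule ev_zigzag) simp_all
qed

text \<open>The same zigzag, now read in the dual pair that belongs to \<open>L\<close>, where
  \<open>coevU d\<close> plays the role of the arbitrary copairing.\<close>

lemma coev_\<phi>:
  assumes [simp]: "d \<in> Obj D"
  shows "(Ident C (ob U d) \<boxtimes> \<phi> d) \<cdot> coev L (ob U d) = coevU d"
proof -
  interpret dual_pair C "ob U d" "ob (dual L) (ob U d)" "ev L (ob U d)" "coev L (ob U d)"
    by (rule CL.dual_pair_ev_coev) simp
  show ?thesis
    unfolding \<phi>_eq_zigzag[OF assms] by (rule coev_zigzag) simp_all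
qed

lemma is_iso_\<phi> [simp]:
  assumes [simp]: "d \<in> Obj D"
  shows "is_iso C (\<phi> d)"
proof -
  interpret L: dual_pair C "ob U d" "ob (dual L) (ob U d)" "ev L (ob U d)" "coev L (ob U d)"
    by (rule CL.dual_pair_ev_coev) simp
  interpret M: dual_pair C "ob U d" "ob U (ob (dual M) d)" "evU d" "coevU d"
    by (rule dual_pair_evU) fact
  \<comment> \<open>The candidate inverse is the zigzag with the two dual pairs exchanged. Both
    composites preserve the respective pairing and so are identities by faithfulness.\<close>
  define \<psi> where "\<psi> = CL.zigzag (ob U (ob (dual M) d)) (ob U d) (ob (dual L) (ob U d)) (evU d) (coev L (ob U d))"
  have \<psi>_simps [simp]: "\<psi> \<in> Mor C" "Dom C \<psi> = ob U (ob (dual M) d)" "Cod C \<psi> = ob (dual L) (ob U d)"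
    by (simp_all add: \<psi>_def)
  have \<psi>: "ev L (ob U d) \<cdot> (\<psi> \<boxtimes> Ident C (ob U d)) = evU d"
    unfolding \<psi>_def by (rule L.ev_zigzag) simp_all
  have "\<phi> d \<cdot> \<psi> = Ident C (ob U (ob (dual M) d))"
  proof (rule M.ev_faithful)
    have "evU d \<cdot> ((\<phi> d \<cdot> \<psi>) \<boxtimes> Ident C (ob U d)) = (evU d \<cdot> (\<phi> d \<boxtimes> Ident C (ob U d))) \<cdot> (\<psi> \<boxtimes> Ident C (ob U d))"
      by simp
    also have "\<dots> = evU d \<cdot> (Ident C (ob U (ob (dual M) d)) \<boxtimes> Ident C (ob U d))"
      by (simp only: evU_\<phi> assms \<psi>) simp
    finally show "evU d \<cdot> ((\<phi> d \<cdot> \<psi>) \<boxtimes> Ident C (ob U d)) = evU d \<cdot> (Ident C (ob U (ob (dual M) d)) \<boxtimes> Ident C (ob U d))" .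
  qed simp_all
  moreover have "\<psi> \<cdot> \<phi> d = Ident C (ob (dual L) (ob U d))"
  proof (rule L.ev_faithful)
    have "ev L (ob U d) \<cdot> ((\<psi> \<cdot> \<phi> d) \<boxtimes> Ident C (ob U d)) = (ev L (ob U d) \<cdot> (\<psi> \<boxtimes> Ident C (ob U d))) \<cdot> (\<phi> d \<boxtimes> Ident C (ob U d))"
      by simp
    also have "\<dots> = ev L (ob U d) \<cdot> (Ident C (ob (dual L) (ob U d)) \<boxtimes> Ident C (ob U d))"
      by (simp only: evU_\<phi> assms \<psi>) simp
    finally show "ev L (ob U d) \<cdot> ((\<psi> \<cdot> \<phi> d) \<boxtimes> Ident C (ob U d)) = ev L (ob U d) \<cdot> (Ident C (ob (dual L) (ob U d)) \<boxtimes> Ident C (ob U d))" .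
  qed simp_all
  ultimately have "inverse_pair C (\<phi> d) \<psi>"
    by (simp add: CL.inverse_pair_iff)
  then show ?thesis
    by (auto simp: is_iso_def)
qed

text \<open>Both sides are tested against \<open>evU\<close>. The morphism \<open>g\<close> changes
  sides twice: dinaturality in \<open>C\<close> moves it off the dual, naturality of
  \<open>s2\<close> brings it under \<open>U\<close>, and dinaturality in \<open>D\<close> moves it
  back onto the dual.\<close>

lemma \<phi>_naturality:
  assumes [simp]: "g \<in> Mor D"
  shows "\<phi> (Dom D g) \<cdot> mor (dual L) (mor U g) = mor U (mor (dual M) g) \<cdot> \<phi> (Cod D g)"
proof -
  let ?d = "Dom D g" and ?d' = "Cod D g"
  interpret dual_pair C "ob U ?d" "ob U (ob (dual M) ?d)" "evU ?d" "coevU ?d"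
    by (rule dual_pair_evU) simp
  show ?thesis
  proof (rule ev_faithful)
    let ?I = "Ident C (ob U ?d)"
    have "evU ?d \<cdot> ((\<phi> ?d \<cdot> mor (dual L) (mor U g)) \<boxtimes> ?I) = (evU ?d \<cdot> (\<phi> ?d \<boxtimes> ?I)) \<cdot> (mor (dual L) (mor U g) \<boxtimes> ?I)"
      by simp
    also have "\<dots> = ev L (ob U ?d') \<cdot> (Ident C (ob (dual L) (ob U ?d')) \<boxtimes> mor U g)"
      using CL.ev_dinaturality[of "mor U g"] by (simp add: evU_\<phi> del: CL.Comp_Comp)
    also have "\<dots> = evU ?d' \<cdot> ((\<phi> ?d' \<boxtimes> Ident C (ob U ?d')) \<cdot> (Ident C (ob (dual L) (ob U ?d')) \<boxtimes> mor U g))"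
      by (simp only: evU_\<phi>[symmetric] DM.Cod_Obj assms) simp
    also have "\<dots> = iso_inv C s0 \<cdot> (mor U (ev M ?d') \<cdot> (s2 (ob (dual M) ?d') ?d'
        \<cdot> ((Ident C (ob U (ob (dual M) ?d')) \<boxtimes> mor U g) \<cdot> (\<phi> ?d' \<boxtimes> ?I))))"
      by simp
    also have "\<dots> = iso_inv C s0 \<cdot> (mor U (ev M ?d') \<cdot> (mor U (Ident D (ob (dual M) ?d') \<boxtimes>\<^bsub>D\<^esub> g)
        \<cdot> (s2 (ob (dual M) ?d') ?d \<cdot> (\<phi> ?d' \<boxtimes> ?I))))"
      using CL.Comp_extend[OF s2_naturality[of "Ident D (ob (dual M) ?d')" g]]
      by (simp del: CL.tensor_Comp CL.tensor_Comp_extend)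
    also have "\<dots> = iso_inv C s0 \<cdot> (mor U (ev M ?d) \<cdot> (mor U (mor (dual M) g \<boxtimes>\<^bsub>D\<^esub> Ident D ?d)
        \<cdot> (s2 (ob (dual M) ?d') ?d \<cdot> (\<phi> ?d' \<boxtimes> ?I))))"
      using arg_cong[OF DM.ev_dinaturality[of g], of "mor U"]
      by (simp add: CL.Comp_extend[of "mor U (ev M ?d)" "mor U (mor (dual M) g \<boxtimes>\<^bsub>D\<^esub> Ident D ?d)"
            "mor U (ev M ?d') \<cdot> mor U (Ident D (ob (dual M) ?d') \<boxtimes>\<^bsub>D\<^esub> g)"])
    also have "\<dots> = evU ?d \<cdot> ((mor U (mor (dual M) g) \<cdot> \<phi> ?d') \<boxtimes> ?I)"
      using CL.Comp_extend[OF s2_naturality[of "mor (dual M) g" "Ident D ?d"], symmetric] by simp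
    finally show "evU ?d \<cdot> ((\<phi> ?d \<cdot> mor (dual L) (mor U g)) \<boxtimes> ?I)
      = evU ?d \<cdot> ((mor U (mor (dual M) g) \<cdot> \<phi> ?d') \<boxtimes> ?I)" .
  qed simp_all
qed

lemma \<phi>_inv_naturality:
  assumes [simp]: "g \<in> Mor D"
  shows "iso_inv C (\<phi> (Dom D g)) \<cdot> mor U (mor (dual M) g) = mor (dual L) (mor U g) \<cdot> iso_inv C (\<phi> (Cod D g))"
  by (simp add: CL.iso_inv_Comp_eq_iff CL.Comp_extend[OF \<phi>_naturality])

section \<open>The structure morphisms of the bimonad as extensions, and the monad laws\<close>

abbreviation T :: "('a, 'f) bimonad_data" where
  "T \<equiv> adjunction_bimonad C D F U \<eta> \<epsilon> s2 s0"

lemma T_simps [simp]: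
  "endo T = U \<circ>\<^sub>F F" "\<mu>\<^bsub>T\<^esub> x = mor U (\<epsilon> (ob F x))" "\<iota>\<^bsub>T\<^esub> = \<eta>"
  by (simp_all add: adjunction_bimonad_def)

lemma \<sigma>2_eq:
  "x \<in> Obj C \<Longrightarrow> y \<in> Obj C \<Longrightarrow> \<sigma>\<^sub>2\<^bsub>T\<^esub> x y = iso_inv C (s2 (ob F x) (ob F y)) \<cdot>
    ext (ob F x \<otimes>\<^bsub>D\<^esub> ob F y) (s2 (ob F x) (ob F y) \<cdot> (\<eta> x \<boxtimes> \<eta> y))"
  by (simp add: adjunction_bimonad_def ext_def)

lemma \<sigma>0_eq: "\<sigma>\<^sub>0\<^bsub>T\<^esub> = iso_inv C s0 \<cdot> ext \<one>\<^bsub>D\<^esub> s0"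
  by (simp add: adjunction_bimonad_def ext_def)

lemma \<sigma>2_simps [simp]:
  assumes "x \<in> Obj C" "y \<in> Obj C"
  shows "\<sigma>\<^sub>2\<^bsub>T\<^esub> x y \<in> Mor C" "Dom C (\<sigma>\<^sub>2\<^bsub>T\<^esub> x y) = ob U (ob F (x \<otimes> y))"
    "Cod C (\<sigma>\<^sub>2\<^bsub>T\<^esub> x y) = ob U (ob F x) \<otimes> ob U (ob F y)"
  using assms by (simp_all add: \<sigma>2_eq)

lemma \<sigma>0_simps [simp]:
  "\<sigma>\<^sub>0\<^bsub>T\<^esub> \<in> Mor C" "Dom C \<sigma>\<^sub>0\<^bsub>T\<^esub> = ob U (ob F \<one>)" "Cod C \<sigma>\<^sub>0\<^bsub>T\<^esub> = \<one>"
  by (simp_all add: \<sigma>0_eq)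

text \<open>Naturality of the inverse of \<open>s2\<close> turns the tensor product into
  \<open>U\<close> of a tensor product in \<open>D\<close>, which enters the extension by
  \<open>mor_ext\<close>. Each bimonad or antipode axiom containing a tensor product after
  \<open>\<sigma>\<^sub>2\<close> is reduced by this rule to the effect of the two factors on the
  units.\<close>

lemma tensor_\<sigma>2:
  assumes [simp]: "f \<in> Mor D" "g \<in> Mor D" "x \<in> Obj C" "y \<in> Obj C"
    and dom: "Dom D f = ob F x" "Dom D g = ob F y"
  shows "(mor U f \<boxtimes> mor U g) \<cdot> \<sigma>\<^sub>2\<^bsub>T\<^esub> x y = iso_inv C (s2 (Cod D f) (Cod D g)) \<cdot>
    ext (Cod D f \<otimes>\<^bsub>D\<^esub> Cod D g) (s2 (Cod D f) (Cod D g) \<cdot> ((mor U f \<cdot> \<eta> x) \<boxtimes> (mor U g \<cdot> \<eta> y)))"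
proof -
  note [simp] = dom
  have "(mor U f \<boxtimes> mor U g) \<cdot> \<sigma>\<^sub>2\<^bsub>T\<^esub> x y = iso_inv C (s2 (Cod D f) (Cod D g)) \<cdot> (mor U (f \<boxtimes>\<^bsub>D\<^esub> g)
      \<cdot> ext (Dom D (f \<boxtimes>\<^bsub>D\<^esub> g)) (s2 (ob F x) (ob F y) \<cdot> (\<eta> x \<boxtimes> \<eta> y)))"
    using CL.Comp_extend[OF s2_inv_naturality[of f g]] by (simp add: \<sigma>2_eq)
  also have "\<dots> = iso_inv C (s2 (Cod D f) (Cod D g)) \<cdot> ext (Cod D f \<otimes>\<^bsub>D\<^esub> Cod D g) (mor U (f \<boxtimes>\<^bsub>D\<^esub> g)
      \<cdot> (s2 (ob F x) (ob F y) \<cdot> (\<eta> x \<boxtimes> \<eta> y)))"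
    by (subst mor_ext) simp_all
  also have "mor U (f \<boxtimes>\<^bsub>D\<^esub> g) \<cdot> (s2 (ob F x) (ob F y) \<cdot> (\<eta> x \<boxtimes> \<eta> y))
     = s2 (Cod D f) (Cod D g) \<cdot> ((mor U f \<cdot> \<eta> x) \<boxtimes> (mor U g \<cdot> \<eta> y))"
    using CL.Comp_extend[OF s2_naturality[of f g], symmetric] by simp
  finally show ?thesis .
qed

text \<open>Associativity is counit naturality at a counit component, mapped by \<open>U\<close>;
  the unit laws are the two triangle identities.\<close>

lemma monad_T: "monad C T"
proof -
  interpret endo: category_functor C C "U \<circ>\<^sub>F F"
    by (rule category_functor_comp) unfold_locales
  interpret endo2: category_functor C C "(U \<circ>\<^sub>F F) \<circ>\<^sub>F (U \<circ>\<^sub>F F)"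
    by (rule category_functor_comp) unfold_locales
  show ?thesis
  proof
    fix f a b assume "f \<in> Hom C a b"
    then show "\<mu>\<^bsub>T\<^esub> b \<cdot> mor (endo T \<circ>\<^sub>F endo T) f = mor (endo T) f \<cdot> \<mu>\<^bsub>T\<^esub> a"
      using counit_naturality[of "mor F f"] by (auto simp: Hom_iff simp flip: U.mor_Comp')
  next
    fix f a b assume "f \<in> Hom C a b"
    then show "\<iota>\<^bsub>T\<^esub> b \<cdot> mor id_functor f = mor (endo T) f \<cdot> \<iota>\<^bsub>T\<^esub> a"
      using unit_naturality[of f] by (auto simp: Hom_iff)
  next
    fix x assume [simp]: "x \<in> Obj C"
    show "\<mu>\<^bsub>T\<^esub> x \<cdot> mor (endo T) (\<mu>\<^bsub>T\<^esub> x) = \<mu>\<^bsub>T\<^esub> x \<cdot> \<mu>\<^bsub>T\<^esub> (ob (endo T) x)"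
      using counit_naturality[of "\<epsilon> (ob F x)"] by (simp flip: U.mor_Comp')
    show "\<mu>\<^bsub>T\<^esub> x \<cdot> \<iota>\<^bsub>T\<^esub> (ob (endo T) x) = Ident C (ob (endo T) x)"
      by (simp add: triangle_right)
    show "\<mu>\<^bsub>T\<^esub> x \<cdot> mor (endo T) (\<iota>\<^bsub>T\<^esub> x) = Ident C (ob (endo T) x)"
      using ext_of_unit[of x] by (simp add: ext_def)
  qed (auto simp: Hom_iff)
qed

section \<open>The bimonad and its antipode\<close>

text \<open>The adjunct of \<open>s2 \<cdot> (\<eta> x \<boxtimes> \<eta> y)\<close>. It presents
  the extension in \<open>\<sigma>\<^sub>2\<close> as a value of \<open>mor U\<close>, the form that
  \<open>tensor_\<sigma>2\<close> requires of its factors when one \<open>\<sigma>\<^sub>2\<close>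
  is applied after another.\<close>

abbreviation h2 :: "'a \<Rightarrow> 'a \<Rightarrow> 'g" where
  "h2 x y \<equiv> \<epsilon> (ob F x \<otimes>\<^bsub>D\<^esub> ob F y) \<cdot>\<^bsub>D\<^esub> mor F (s2 (ob F x) (ob F y) \<cdot> (\<eta> x \<boxtimes> \<eta> y))"

lemma mor_h2_unit:
  "x \<in> Obj C \<Longrightarrow> y \<in> Obj C \<Longrightarrow> mor U (h2 x y) \<cdot> \<eta> (x \<otimes> y) = s2 (ob F x) (ob F y) \<cdot> (\<eta> x \<boxtimes> \<eta> y)"
  by (subst ext_eq_mor[symmetric]) (simp_all add: ext_unit del: F.mor_Comp' U.mor_Comp')

lemma \<sigma>2_eq_mor:
  "x \<in> Obj C \<Longrightarrow> y \<in> Obj C \<Longrightarrow> \<sigma>\<^sub>2\<^bsub>T\<^esub> x y = iso_inv C (s2 (ob F x) (ob F y)) \<cdot> mor U (h2 x y)"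
  by (subst \<sigma>2_eq) (simp_all add: ext_eq_mor del: F.mor_Comp' U.mor_Comp')

lemma opmonoidal_T: "opmonoidal_functor C T"
proof -
  interpret endo: category_functor C C "U \<circ>\<^sub>F F"
    by (rule category_functor_comp) unfold_locales
  show ?thesis
  proof
    fix f x x' g y y' assume "f \<in> Hom C x x'" "g \<in> Hom C y y'"
    then have fg [simp]: "f \<in> Mor C" "Dom C f = x" "Cod C f = x'" "g \<in> Mor C" "Dom C g = y" "Cod C g = y'"
      by (auto simp: Hom_iff)
    then have [simp]: "x \<in> Obj C" "x' \<in> Obj C" "y \<in> Obj C" "y' \<in> Obj C"
      by (auto simp del: fg)
    \<comment> \<open>Both sides of naturality extend the same morphism, because
      \<open>\<eta>\<close> is natural in each tensor factor.\<close>
    have "\<sigma>\<^sub>2\<^bsub>T\<^esub> x' y' \<cdot> mor U (mor F (f \<boxtimes> g)) = iso_inv C (s2 (ob F x') (ob F y')) \<cdot>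
        ext (ob F x' \<otimes>\<^bsub>D\<^esub> ob F y') (s2 (ob F x') (ob F y') \<cdot> ((\<eta> x' \<cdot> f) \<boxtimes> (\<eta> y' \<cdot> g)))"
      by (simp add: \<sigma>2_eq)
    also have "\<dots> = (mor U (mor F f) \<boxtimes> mor U (mor F g)) \<cdot> \<sigma>\<^sub>2\<^bsub>T\<^esub> x y"
      using unit_naturality[of f] unit_naturality[of g] by (simp add: tensor_\<sigma>2)
    finally show "\<sigma>\<^sub>2\<^bsub>T\<^esub> x' y' \<cdot> mor (endo T) (f \<boxtimes> g) = (mor (endo T) f \<boxtimes> mor (endo T) g) \<cdot> \<sigma>\<^sub>2\<^bsub>T\<^esub> x y"
      by simp
  next
    fix x y z assume [simp]: "x \<in> Obj C" "y \<in> Obj C" "z \<in> Obj C"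
    \<comment> \<open>For coassociativity both sides are brought to the form \<open>?i\<close> after
      an inverse \<open>s2\<close> after \<open>?e ?k\<close>.\<close>
    let ?x = "ob F x" and ?y = "ob F y" and ?z = "ob F z"
    let ?i = "Ident C (ob U ?x) \<boxtimes> iso_inv C (s2 ?y ?z)"
    let ?j = "iso_inv C (s2 ?x ?y) \<boxtimes> Ident C (ob U ?z)"
    let ?k = "s2 ?x (?y \<otimes>\<^bsub>D\<^esub> ?z) \<cdot> ((\<eta> x \<boxtimes> (s2 ?y ?z \<cdot> (\<eta> y \<boxtimes> \<eta> z))) \<cdot> assoc C x y z)"
    let ?e = "ext (?x \<otimes>\<^bsub>D\<^esub> (?y \<otimes>\<^bsub>D\<^esub> ?z))"
    have "assoc C (ob U ?x) (ob U ?y) (ob U ?z) \<cdot> ((\<sigma>\<^sub>2\<^bsub>T\<^esub> x y \<boxtimes> Ident C (ob U ?z)) \<cdot> \<sigma>\<^sub>2\<^bsub>T\<^esub> (x \<otimes> y) z)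
      = assoc C (ob U ?x) (ob U ?y) (ob U ?z) \<cdot> (?j \<cdot> ((mor U (h2 x y) \<boxtimes> mor U (Ident D ?z)) \<cdot> \<sigma>\<^sub>2\<^bsub>T\<^esub> (x \<otimes> y) z))"
      by (simp add: \<sigma>2_eq_mor[of x y] del: F.mor_Comp' U.mor_Comp')
    also have "(mor U (h2 x y) \<boxtimes> mor U (Ident D ?z)) \<cdot> \<sigma>\<^sub>2\<^bsub>T\<^esub> (x \<otimes> y) z
      = iso_inv C (s2 (?x \<otimes>\<^bsub>D\<^esub> ?y) ?z) \<cdot> ext ((?x \<otimes>\<^bsub>D\<^esub> ?y) \<otimes>\<^bsub>D\<^esub> ?z) (s2 (?x \<otimes>\<^bsub>D\<^esub> ?y) ?z
        \<cdot> ((s2 ?x ?y \<cdot> (\<eta> x \<boxtimes> \<eta> y)) \<boxtimes> \<eta> z))"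
      by (subst tensor_\<sigma>2) (simp_all add: mor_h2_unit del: F.mor_Comp' U.mor_Comp')
    \<comment> \<open>The associator of \<open>C\<close> is exchanged for the image under
      \<open>U\<close> of the one of \<open>D\<close>, which can enter the extension; inside, it is
      exchanged back and passes the units.\<close>
    also have "assoc C (ob U ?x) (ob U ?y) (ob U ?z) \<cdot> (?j \<cdot> (iso_inv C (s2 (?x \<otimes>\<^bsub>D\<^esub> ?y) ?z)
        \<cdot> ext ((?x \<otimes>\<^bsub>D\<^esub> ?y) \<otimes>\<^bsub>D\<^esub> ?z) (s2 (?x \<otimes>\<^bsub>D\<^esub> ?y) ?z \<cdot> ((s2 ?x ?y \<cdot> (\<eta> x \<boxtimes> \<eta> y)) \<boxtimes> \<eta> z))))
      = ?i \<cdot> (iso_inv C (s2 ?x (?y \<otimes>\<^bsub>D\<^esub> ?z)) \<cdot> (mor U (assoc D ?x ?y ?z)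
        \<cdot> ext ((?x \<otimes>\<^bsub>D\<^esub> ?y) \<otimes>\<^bsub>D\<^esub> ?z) (s2 (?x \<otimes>\<^bsub>D\<^esub> ?y) ?z \<cdot> ((s2 ?x ?y \<cdot> (\<eta> x \<boxtimes> \<eta> y)) \<boxtimes> \<eta> z))))"
      by (simp add: CL.Comp_extend3[OF s2_inv_assoc])
    also have "mor U (assoc D ?x ?y ?z)
        \<cdot> ext ((?x \<otimes>\<^bsub>D\<^esub> ?y) \<otimes>\<^bsub>D\<^esub> ?z) (s2 (?x \<otimes>\<^bsub>D\<^esub> ?y) ?z \<cdot> ((s2 ?x ?y \<cdot> (\<eta> x \<boxtimes> \<eta> y)) \<boxtimes> \<eta> z))
      = ?e (mor U (assoc D ?x ?y ?z) \<cdot> (s2 (?x \<otimes>\<^bsub>D\<^esub> ?y) ?z \<cdot> ((s2 ?x ?y \<cdot> (\<eta> x \<boxtimes> \<eta> y)) \<boxtimes> \<eta> z)))"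
      using mor_ext[of "assoc D ?x ?y ?z"] by simp
    also have "mor U (assoc D ?x ?y ?z) \<cdot> (s2 (?x \<otimes>\<^bsub>D\<^esub> ?y) ?z \<cdot> ((s2 ?x ?y \<cdot> (\<eta> x \<boxtimes> \<eta> y)) \<boxtimes> \<eta> z))
      = mor U (assoc D ?x ?y ?z) \<cdot> (s2 (?x \<otimes>\<^bsub>D\<^esub> ?y) ?z \<cdot> ((s2 ?x ?y \<boxtimes> Ident C (ob U ?z)) \<cdot> ((\<eta> x \<boxtimes> \<eta> y) \<boxtimes> \<eta> z)))"
      by simp
    also have "\<dots> = s2 ?x (?y \<otimes>\<^bsub>D\<^esub> ?z) \<cdot> ((Ident C (ob U ?x) \<boxtimes> s2 ?y ?z)
        \<cdot> (assoc C (ob U ?x) (ob U ?y) (ob U ?z) \<cdot> ((\<eta> x \<boxtimes> \<eta> y) \<boxtimes> \<eta> z)))"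
      by (simp add: CL.Comp_extend3[OF s2_assoc'] del: CL.tensor_Comp CL.tensor_Comp_extend)
    also have "\<dots> = ?k"
      using CL.assoc_naturality[of "\<eta> x" "\<eta> y" "\<eta> z"] by simp
    \<comment> \<open>The right-hand side of the axiom is reached by reading
      \<open>tensor_\<sigma>2\<close> backwards; the associator at the end of \<open>?k\<close>
      leaves the extension as its image under \<open>U F\<close>.\<close>
    also have "iso_inv C (s2 ?x (?y \<otimes>\<^bsub>D\<^esub> ?z)) \<cdot> ?e ?k
      = (mor U (Ident D ?x) \<boxtimes> mor U (h2 y z)) \<cdot> (\<sigma>\<^sub>2\<^bsub>T\<^esub> x (y \<otimes> z) \<cdot> mor U (mor F (assoc C x y z)))"
    proof -
      have "(mor U (Ident D ?x) \<boxtimes> mor U (h2 y z)) \<cdot> \<sigma>\<^sub>2\<^bsub>T\<^esub> x (y \<otimes> z)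
        = iso_inv C (s2 ?x (?y \<otimes>\<^bsub>D\<^esub> ?z)) \<cdot> ?e (s2 ?x (?y \<otimes>\<^bsub>D\<^esub> ?z) \<cdot> (\<eta> x \<boxtimes> (s2 ?y ?z \<cdot> (\<eta> y \<boxtimes> \<eta> z))))"
        by (subst tensor_\<sigma>2) (simp_all add: mor_h2_unit del: F.mor_Comp' U.mor_Comp')
      then show ?thesis
        by (simp add: CL.Comp_extend[of "mor U (Ident D ?x) \<boxtimes> mor U (h2 y z)"] del: F.mor_Comp' U.mor_Comp' U.mor_Ident' F.mor_Ident')
    qed
    also have "?i \<cdot> \<dots> = (Ident C (ob U ?x) \<boxtimes> \<sigma>\<^sub>2\<^bsub>T\<^esub> y z) \<cdot> (\<sigma>\<^sub>2\<^bsub>T\<^esub> x (y \<otimes> z) \<cdot> mor U (mor F (assoc C x y z)))"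
      by (simp add: \<sigma>2_eq_mor[of y z] del: F.mor_Comp' U.mor_Comp')
    finally show "assoc C (ob (endo T) x) (ob (endo T) y) (ob (endo T) z)
          \<cdot> (\<sigma>\<^sub>2\<^bsub>T\<^esub> x y \<boxtimes> Ident C (ob (endo T) z)) \<cdot> \<sigma>\<^sub>2\<^bsub>T\<^esub> (x \<otimes> y) z
        = (Ident C (ob (endo T) x) \<boxtimes> \<sigma>\<^sub>2\<^bsub>T\<^esub> y z) \<cdot> \<sigma>\<^sub>2\<^bsub>T\<^esub> x (y \<otimes> z) \<cdot> mor (endo T) (assoc C x y z)"
      by simp
  next
    fix x assume [simp]: "x \<in> Obj C"
    let ?x = "ob F x" and ?u = "\<one>\<^bsub>D\<^esub>"
    \<comment> \<open>This is the adjunct of \<open>s0\<close>; it presents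
      \<open>\<sigma>\<^sub>0\<close> as the inverse of \<open>s0\<close> after a value of
      \<open>mor U\<close>.\<close>
    let ?h = "\<epsilon> \<one>\<^bsub>D\<^esub> \<cdot>\<^bsub>D\<^esub> mor F s0"
    have h: "mor U ?h \<cdot> \<eta> \<one> = s0"
      by (subst ext_eq_mor[symmetric]) (simp_all add: ext_unit del: F.mor_Comp' U.mor_Comp')
    have \<sigma>0: "\<sigma>\<^sub>0\<^bsub>T\<^esub> = iso_inv C s0 \<cdot> mor U ?h"
      by (simp add: \<sigma>0_eq ext_eq_mor del: F.mor_Comp' U.mor_Comp')
    have "lunit C (ob U ?x) \<cdot> ((\<sigma>\<^sub>0\<^bsub>T\<^esub> \<boxtimes> Ident C (ob U ?x)) \<cdot> \<sigma>\<^sub>2\<^bsub>T\<^esub> \<one> x)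
      = lunit C (ob U ?x) \<cdot> ((iso_inv C s0 \<boxtimes> Ident C (ob U ?x)) \<cdot> ((mor U ?h \<boxtimes> mor U (Ident D ?x)) \<cdot> \<sigma>\<^sub>2\<^bsub>T\<^esub> \<one> x))"
      by (simp add: \<sigma>0 del: F.mor_Comp' U.mor_Comp')
    also have "(mor U ?h \<boxtimes> mor U (Ident D ?x)) \<cdot> \<sigma>\<^sub>2\<^bsub>T\<^esub> \<one> x
      = iso_inv C (s2 ?u ?x) \<cdot> ext (?u \<otimes>\<^bsub>D\<^esub> ?x) (s2 ?u ?x \<cdot> (s0 \<boxtimes> \<eta> x))"
      by (subst tensor_\<sigma>2) (simp_all add: h del: F.mor_Comp' U.mor_Comp')
    \<comment> \<open>Expanding the unitor by the unit law of \<open>U\<close> cancels the inverses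
      of \<open>s0\<close> and \<open>s2\<close>. The extended morphism becomes
      \<open>\<eta> x \<cdot> lunit C x\<close>, whose extension is the image of
      \<open>lunit C x\<close> under \<open>U F\<close>.\<close>
    also have "lunit C (ob U ?x) \<cdot> ((iso_inv C s0 \<boxtimes> Ident C (ob U ?x)) \<cdot> (iso_inv C (s2 ?u ?x)
        \<cdot> ext (?u \<otimes>\<^bsub>D\<^esub> ?x) (s2 ?u ?x \<cdot> (s0 \<boxtimes> \<eta> x))))
      = mor U (lunit D ?x) \<cdot> ext (?u \<otimes>\<^bsub>D\<^esub> ?x) (s2 ?u ?x \<cdot> (s0 \<boxtimes> \<eta> x))"
      by (simp add: s2_lunit'[symmetric])
    also have "\<dots> = ext ?x (mor U (lunit D ?x) \<cdot> (s2 ?u ?x \<cdot> (s0 \<boxtimes> \<eta> x)))"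
      using mor_ext[of "lunit D ?x"] by simp
    also have "mor U (lunit D ?x) \<cdot> (s2 ?u ?x \<cdot> (s0 \<boxtimes> \<eta> x)) = lunit C (ob U ?x) \<cdot> (Ident C \<one> \<boxtimes> \<eta> x)"
      by (simp add: s2_lunit'[symmetric])
    also have "\<dots> = \<eta> x \<cdot> lunit C x"
      using CL.lunit_naturality[of "\<eta> x"] by simp
    finally show "lunit C (ob (endo T) x) \<cdot> (\<sigma>\<^sub>0\<^bsub>T\<^esub> \<boxtimes> Ident C (ob (endo T) x)) \<cdot> \<sigma>\<^sub>2\<^bsub>T\<^esub> \<one> x
        = mor (endo T) (lunit C x)"
      by (simp add: ext_unit_Comp)
    have "runit C (ob U ?x) \<cdot> ((Ident C (ob U ?x) \<boxtimes> \<sigma>\<^sub>0\<^bsub>T\<^esub>) \<cdot> \<sigma>\<^sub>2\<^bsub>T\<^esub> x \<one>)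
      = runit C (ob U ?x) \<cdot> ((Ident C (ob U ?x) \<boxtimes> iso_inv C s0) \<cdot> ((mor U (Ident D ?x) \<boxtimes> mor U ?h) \<cdot> \<sigma>\<^sub>2\<^bsub>T\<^esub> x \<one>))"
      by (simp add: \<sigma>0 del: F.mor_Comp' U.mor_Comp')
    also have "(mor U (Ident D ?x) \<boxtimes> mor U ?h) \<cdot> \<sigma>\<^sub>2\<^bsub>T\<^esub> x \<one>
      = iso_inv C (s2 ?x ?u) \<cdot> ext (?x \<otimes>\<^bsub>D\<^esub> ?u) (s2 ?x ?u \<cdot> (\<eta> x \<boxtimes> s0))"
      by (subst tensor_\<sigma>2) (simp_all add: h del: F.mor_Comp' U.mor_Comp')
    also have "runit C (ob U ?x) \<cdot> ((Ident C (ob U ?x) \<boxtimes> iso_inv C s0) \<cdot> (iso_inv C (s2 ?x ?u)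
        \<cdot> ext (?x \<otimes>\<^bsub>D\<^esub> ?u) (s2 ?x ?u \<cdot> (\<eta> x \<boxtimes> s0))))
      = mor U (runit D ?x) \<cdot> ext (?x \<otimes>\<^bsub>D\<^esub> ?u) (s2 ?x ?u \<cdot> (\<eta> x \<boxtimes> s0))"
      by (simp add: s2_runit'[symmetric])
    also have "\<dots> = ext ?x (mor U (runit D ?x) \<cdot> (s2 ?x ?u \<cdot> (\<eta> x \<boxtimes> s0)))"
      using mor_ext[of "runit D ?x"] by simp
    also have "mor U (runit D ?x) \<cdot> (s2 ?x ?u \<cdot> (\<eta> x \<boxtimes> s0)) = runit C (ob U ?x) \<cdot> (\<eta> x \<boxtimes> Ident C \<one>)"
      by (simp add: s2_runit'[symmetric])
    also have "\<dots> = \<eta> x \<cdot> runit C x"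
      using CL.runit_naturality[of "\<eta> x"] by simp
    finally show "runit C (ob (endo T) x) \<cdot> (Ident C (ob (endo T) x) \<boxtimes> \<sigma>\<^sub>0\<^bsub>T\<^esub>) \<cdot> \<sigma>\<^sub>2\<^bsub>T\<^esub> x \<one>
        = mor (endo T) (runit C x)"
      by (simp add: ext_unit_Comp)
  qed (auto simp: Hom_iff)
qed

text \<open>The axioms for the unit are \<open>ext_unit\<close>. Those for the multiplication say
  that two descriptions of an iterated extension agree.\<close>

lemma bimonad_T: "bimonad C T"
proof -
  interpret monad C T by (rule monad_T)
  interpret opmonoidal_functor C T by (rule opmonoidal_T)
  show ?thesis
  proof
    fix x y assume [simp]: "x \<in> Obj C" "y \<in> Obj C"
    let ?x = "ob F x" and ?y = "ob F y"
    let ?k = "s2 ?x ?y \<cdot> (\<eta> x \<boxtimes> \<eta> y)"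
    have "\<sigma>\<^sub>2\<^bsub>T\<^esub> x y \<cdot> \<mu>\<^bsub>T\<^esub> (x \<otimes> y) = iso_inv C (s2 ?x ?y) \<cdot> ext (?x \<otimes>\<^bsub>D\<^esub> ?y) (ext (?x \<otimes>\<^bsub>D\<^esub> ?y) ?k)"
      by (simp add: \<sigma>2_eq ext_mult)
    \<comment> \<open>The inner extension is \<open>s2\<close> after
      \<open>\<sigma>\<^sub>2\<close>, so the second factor can be pulled out of the outer
      one.\<close>
    also have "\<dots> = iso_inv C (s2 ?x ?y) \<cdot> (ext (?x \<otimes>\<^bsub>D\<^esub> ?y) (s2 ?x ?y) \<cdot> mor U (mor F (\<sigma>\<^sub>2\<^bsub>T\<^esub> x y)))"
      by (simp add: \<sigma>2_eq del: F.mor_Comp' U.mor_Comp')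
    \<comment> \<open>In \<open>tensor_\<sigma>2\<close> both factors are now counits; a triangle
      identity cancels each against its unit, which leaves the extension of \<open>s2\<close>
      alone.\<close>
    also have "\<dots> = ((\<mu>\<^bsub>T\<^esub> x \<boxtimes> \<mu>\<^bsub>T\<^esub> y) \<cdot> \<sigma>\<^sub>2\<^bsub>T\<^esub> (ob (endo T) x) (ob (endo T) y)) \<cdot> mor (endo T) (\<sigma>\<^sub>2\<^bsub>T\<^esub> x y)"
      by (simp add: tensor_\<sigma>2 triangle_right del: F.mor_Comp' U.mor_Comp' ext_mor)
    finally show "\<sigma>\<^sub>2\<^bsub>T\<^esub> x y \<cdot> \<mu>\<^bsub>T\<^esub> (x \<otimes> y)
        = (\<mu>\<^bsub>T\<^esub> x \<boxtimes> \<mu>\<^bsub>T\<^esub> y) \<cdot> \<sigma>\<^sub>2\<^bsub>T\<^esub> (ob (endo T) x) (ob (endo T) y) \<cdot> mor (endo T) (\<sigma>\<^sub>2\<^bsub>T\<^esub> x y)" .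
    show "\<sigma>\<^sub>2\<^bsub>T\<^esub> x y \<cdot> \<iota>\<^bsub>T\<^esub> (x \<otimes> y) = \<iota>\<^bsub>T\<^esub> x \<boxtimes> \<iota>\<^bsub>T\<^esub> y"
      by (simp add: \<sigma>2_eq ext_unit)
  next
    have "\<sigma>\<^sub>0\<^bsub>T\<^esub> \<cdot> \<mu>\<^bsub>T\<^esub> \<one> = iso_inv C s0 \<cdot> ext \<one>\<^bsub>D\<^esub> (ext \<one>\<^bsub>D\<^esub> s0)"
      by (simp add: \<sigma>0_eq ext_mult)
    also have "\<dots> = iso_inv C s0 \<cdot> (ext \<one>\<^bsub>D\<^esub> s0 \<cdot> mor U (mor F \<sigma>\<^sub>0\<^bsub>T\<^esub>))"
      by (simp add: \<sigma>0_eq del: F.mor_Comp' U.mor_Comp')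
    also have "\<dots> = \<sigma>\<^sub>0\<^bsub>T\<^esub> \<cdot> mor (endo T) \<sigma>\<^sub>0\<^bsub>T\<^esub>"
      by (simp add: \<sigma>0_eq del: F.mor_Comp' U.mor_Comp' ext_mor)
    finally show "\<sigma>\<^sub>0\<^bsub>T\<^esub> \<cdot> \<mu>\<^bsub>T\<^esub> \<one> = \<sigma>\<^sub>0\<^bsub>T\<^esub> \<cdot> mor (endo T) \<sigma>\<^sub>0\<^bsub>T\<^esub>" .
    show "\<sigma>\<^sub>0\<^bsub>T\<^esub> \<cdot> \<iota>\<^bsub>T\<^esub> \<one> = Ident C \<one>"
      by (simp add: \<sigma>0_eq ext_unit)
  qed
qed

section \<open>The antipode, its naturality and its two axioms\<close>

abbreviation S :: "'a \<Rightarrow> 'f" where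
  "S \<equiv> adjunction_antipode C D L M F U \<eta> \<epsilon> s2 s0"

lemma S_eq:
  "x \<in> Obj C \<Longrightarrow> S x = mor (dual L) (\<eta> x) \<cdot> (iso_inv C (\<phi> (ob F x)) \<cdot> ext (ob (dual M) (ob F x)) (\<phi> (ob F x)))"
  by (simp add: adjunction_antipode_def Let_def ext_def)

lemma S_simps [simp]:
  assumes "x \<in> Obj C"
  shows "S x \<in> Mor C" "Dom C (S x) = ob U (ob F (ob (dual L) (ob U (ob F x))))" "Cod C (S x) = ob (dual L) x"
  using assms by (simp_all add: S_eq)

text \<open>The dual of \<open>U F f\<close> passes \<open>\<phi>\<close> by naturality, leaves the
  extension by \<open>mor_ext\<close> and passes the inverse of \<open>\<phi>\<close>. The final
  step is naturality of \<open>\<eta>\<close> under the contravariant dual.\<close>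

lemma S_naturality:
  assumes [simp]: "f \<in> Mor C"
  shows "S (Dom C f) \<cdot> mor U (mor F (mor (dual L) (mor U (mor F f)))) = mor (dual L) f \<cdot> S (Cod C f)"
proof -
  let ?x = "Dom C f" and ?y = "Cod C f"
  let ?Mx = "ob (dual M) (ob F ?x)" and ?My = "ob (dual M) (ob F ?y)"
  have "S ?x \<cdot> mor U (mor F (mor (dual L) (mor U (mor F f)))) = mor (dual L) (\<eta> ?x)
      \<cdot> (iso_inv C (\<phi> (ob F ?x)) \<cdot> ext ?Mx (\<phi> (ob F ?x) \<cdot> mor (dual L) (mor U (mor F f))))"
    by (simp add: S_eq)
  also have "\<dots> = mor (dual L) (\<eta> ?x) \<cdot> (iso_inv C (\<phi> (ob F ?x)) \<cdot> (mor U (mor (dual M) (mor F f)) \<cdot> ext ?My (\<phi> (ob F ?y))))"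
    using \<phi>_naturality[of "mor F f"] mor_ext[of "mor (dual M) (mor F f)" "\<phi> (ob F ?y)"] by simp
  also have "\<dots> = mor (dual L) (\<eta> ?x) \<cdot> (mor (dual L) (mor U (mor F f)) \<cdot> (iso_inv C (\<phi> (ob F ?y)) \<cdot> ext ?My (\<phi> (ob F ?y))))"
    using CL.Comp_extend[OF \<phi>_inv_naturality[of "mor F f"]] by simp
  also have "\<dots> = mor (dual L) (mor U (mor F f) \<cdot> \<eta> ?x) \<cdot> (iso_inv C (\<phi> (ob F ?y)) \<cdot> ext ?My (\<phi> (ob F ?y)))"
    by simp
  also have "\<dots> = mor (dual L) (\<eta> ?y \<cdot> f) \<cdot> (iso_inv C (\<phi> (ob F ?y)) \<cdot> ext ?My (\<phi> (ob F ?y)))"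
    by (simp only: unit_naturality assms)
  also have "\<dots> = mor (dual L) f \<cdot> S ?y"
    by (simp add: S_eq)
  finally show ?thesis .
qed

text \<open>The factor of the first antipode axiom to which \<open>ev\<close> is applied. The counit
  makes the same journey as in \<open>S_naturality\<close> and finally meets the dual of a unit,
  where a triangle identity cancels both.\<close>

lemma S_mult:
  assumes [simp]: "x \<in> Obj C"
  shows "S (ob U (ob F x)) \<cdot> mor U (mor F (mor (dual L) (mor U (\<epsilon> (ob F x)))))
    = iso_inv C (\<phi> (ob F x)) \<cdot> ext (ob (dual M) (ob F x)) (\<phi> (ob F x))"
proof -
  let ?d = "ob F x" let ?d' = "ob F (ob U ?d)"
  have "S (ob U ?d) \<cdot> mor U (mor F (mor (dual L) (mor U (\<epsilon> ?d)))) = mor (dual L) (\<eta> (ob U ?d))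
      \<cdot> (iso_inv C (\<phi> ?d') \<cdot> ext (ob (dual M) ?d') (\<phi> ?d' \<cdot> mor (dual L) (mor U (\<epsilon> ?d))))"
    by (simp add: S_eq)
  also have "\<dots> = mor (dual L) (\<eta> (ob U ?d)) \<cdot> (iso_inv C (\<phi> ?d') \<cdot> (mor U (mor (dual M) (\<epsilon> ?d)) \<cdot> ext (ob (dual M) ?d) (\<phi> ?d)))"
    using \<phi>_naturality[of "\<epsilon> ?d"] mor_ext[of "mor (dual M) (\<epsilon> ?d)" "\<phi> ?d"] by simp
  also have "\<dots> = mor (dual L) (\<eta> (ob U ?d)) \<cdot> (mor (dual L) (mor U (\<epsilon> ?d)) \<cdot> (iso_inv C (\<phi> ?d) \<cdot> ext (ob (dual M) ?d) (\<phi> ?d)))"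
    using CL.Comp_extend[OF \<phi>_inv_naturality[of "\<epsilon> ?d"]] by simp
  also have "\<dots> = mor (dual L) (mor U (\<epsilon> ?d) \<cdot> \<eta> (ob U ?d)) \<cdot> (iso_inv C (\<phi> ?d) \<cdot> ext (ob (dual M) ?d) (\<phi> ?d))"
    by simp
  also have "\<dots> = iso_inv C (\<phi> ?d) \<cdot> ext (ob (dual M) ?d) (\<phi> ?d)"
    by (simp only: triangle_right F.ob_Obj assms) simp
  finally show ?thesis .
qed

lemma ev_\<phi>_inv:
  assumes [simp]: "d \<in> Obj D"
  shows "ev L (ob U d) \<cdot> (iso_inv C (\<phi> d) \<boxtimes> Ident C (ob U d)) = evU d"
  by (simp add: evU_\<phi>[symmetric])

lemma \<phi>_inv_coevU:
  assumes [simp]: "d \<in> Obj D"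
  shows "(Ident C (ob U d) \<boxtimes> iso_inv C (\<phi> d)) \<cdot> coevU d = coev L (ob U d)"
  by (simp only: coev_\<phi>[symmetric] assms) simp

text \<open>The inverse of \<open>\<phi>\<close> left by \<open>S_mult\<close> turns the evaluation
  of \<open>C\<close> into \<open>evU\<close>, which can enter the extension because its middle
  factor lies in the image of \<open>U\<close>.\<close>

lemma antipode_ev_S:
  assumes [simp]: "x \<in> Obj C"
  shows "ev L (ob U (ob F x)) \<cdot> (((S (ob U (ob F x)) \<cdot> mor U (mor F (mor (dual L) (mor U (\<epsilon> (ob F x))))))
      \<boxtimes> Ident C (ob U (ob F x))) \<cdot> \<sigma>\<^sub>2\<^bsub>T\<^esub> (ob (dual L) (ob U (ob F x))) x)
    = \<sigma>\<^sub>0\<^bsub>T\<^esub> \<cdot> mor U (mor F (ev L x \<cdot> (mor (dual L) (\<eta> x) \<boxtimes> Ident C x)))"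
proof -
  let ?d = "ob F x" let ?U = "ob U ?d" and ?b = "ob (dual L) (ob U ?d)" and ?m = "ob (dual M) ?d"
  let ?h = "\<epsilon> ?m \<cdot>\<^bsub>D\<^esub> mor F (\<phi> ?d)"
  have h: "mor U ?h = ext ?m (\<phi> ?d)"
    by (simp add: ext_def)
  have "ev L ?U \<cdot> (((S ?U \<cdot> mor U (mor F (mor (dual L) (mor U (\<epsilon> ?d))))) \<boxtimes> Ident C ?U) \<cdot> \<sigma>\<^sub>2\<^bsub>T\<^esub> ?b x)
    = (ev L ?U \<cdot> (iso_inv C (\<phi> ?d) \<boxtimes> Ident C ?U)) \<cdot> ((mor U ?h \<boxtimes> mor U (Ident D ?d)) \<cdot> \<sigma>\<^sub>2\<^bsub>T\<^esub> ?b x)"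
    by (simp add: S_mult h del: F.mor_Comp' U.mor_Comp')
  also have "\<dots> = evU ?d \<cdot> ((mor U ?h \<boxtimes> mor U (Ident D ?d)) \<cdot> \<sigma>\<^sub>2\<^bsub>T\<^esub> ?b x)"
    by (simp only: ev_\<phi>_inv U.ob_Obj F.ob_Obj assms)
  also have "(mor U ?h \<boxtimes> mor U (Ident D ?d)) \<cdot> \<sigma>\<^sub>2\<^bsub>T\<^esub> ?b x
    = iso_inv C (s2 ?m ?d) \<cdot> ext (?m \<otimes>\<^bsub>D\<^esub> ?d) (s2 ?m ?d \<cdot> (\<phi> ?d \<boxtimes> \<eta> x))"
    by (subst tensor_\<sigma>2) (simp_all add: h ext_unit del: F.mor_Comp' U.mor_Comp')
  also have "evU ?d \<cdot> \<dots> = iso_inv C s0 \<cdot> (mor U (ev M ?d) \<cdot> ext (?m \<otimes>\<^bsub>D\<^esub> ?d) (s2 ?m ?d \<cdot> (\<phi> ?d \<boxtimes> \<eta> x)))"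
    by simp
  also have "\<dots> = iso_inv C s0 \<cdot> ext \<one>\<^bsub>D\<^esub> (mor U (ev M ?d) \<cdot> (s2 ?m ?d \<cdot> (\<phi> ?d \<boxtimes> \<eta> x)))"
    using mor_ext[of "ev M ?d"] by simp
  \<comment> \<open>Splitting \<open>\<phi> ?d \<boxtimes> \<eta> x\<close> by interchange lets
    \<open>evU\<close> absorb \<open>\<phi>\<close>; dinaturality then turns \<open>\<eta> x\<close>
    into its dual.\<close>
  also have "mor U (ev M ?d) \<cdot> (s2 ?m ?d \<cdot> (\<phi> ?d \<boxtimes> \<eta> x)) = s0 \<cdot> ((evU ?d \<cdot> (\<phi> ?d \<boxtimes> Ident C ?U)) \<cdot> (Ident C ?b \<boxtimes> \<eta> x))"
    by simp
  also have "\<dots> = s0 \<cdot> (ev L x \<cdot> (mor (dual L) (\<eta> x) \<boxtimes> Ident C x))"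
    using CL.ev_dinaturality[of "\<eta> x"] by (simp only: evU_\<phi> U.ob_Obj F.ob_Obj assms) simp
  also have "iso_inv C s0 \<cdot> ext \<one>\<^bsub>D\<^esub> \<dots> = \<sigma>\<^sub>0\<^bsub>T\<^esub> \<cdot> mor U (mor F (ev L x \<cdot> (mor (dual L) (\<eta> x) \<boxtimes> Ident C x)))"
    by (simp add: \<sigma>0_eq del: F.mor_Comp' U.mor_Comp')
  finally show ?thesis .
qed

text \<open>On the first leg the counit cancels against the unit, so that only \<open>\<phi>\<close>
  acts on the coevaluation inside the extension. That composite is \<open>coevU\<close>, whose part
  in the image of \<open>U\<close> is moved out again, leaving
  \<open>\<sigma>\<^sub>0\<close>.\<close>

lemma antipode_coev_S:
  assumes [simp]: "x \<in> Obj C"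
  shows "(mor U (\<epsilon> (ob F x)) \<boxtimes> S x) \<cdot> (\<sigma>\<^sub>2\<^bsub>T\<^esub> (ob U (ob F x)) (ob (dual L) (ob U (ob F x)))
      \<cdot> mor U (mor F (coev L (ob U (ob F x)))))
    = (\<eta> x \<boxtimes> Ident C (ob (dual L) x)) \<cdot> (coev L x \<cdot> \<sigma>\<^sub>0\<^bsub>T\<^esub>)"
proof -
  let ?d = "ob F x" let ?U = "ob U ?d" and ?b = "ob (dual L) (ob U ?d)" and ?m = "ob (dual M) ?d"
  let ?h = "\<epsilon> ?m \<cdot>\<^bsub>D\<^esub> mor F (\<phi> ?d)" and ?c = "coev L (ob U ?d)"
  \<comment> \<open>The part of \<open>S x\<close> that stands outside the extension and has to wait
    until the coevaluation has left it.\<close>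
  let ?j = "Ident C ?U \<boxtimes> (mor (dual L) (\<eta> x) \<cdot> iso_inv C (\<phi> ?d))"
  have h: "mor U ?h = ext ?m (\<phi> ?d)"
    by (simp add: ext_def)
  have "(mor U (\<epsilon> ?d) \<boxtimes> S x) \<cdot> (\<sigma>\<^sub>2\<^bsub>T\<^esub> ?U ?b \<cdot> mor U (mor F ?c))
    = ?j \<cdot> (((mor U (\<epsilon> ?d) \<boxtimes> mor U ?h) \<cdot> \<sigma>\<^sub>2\<^bsub>T\<^esub> ?U ?b) \<cdot> mor U (mor F ?c))"
    by (simp add: S_eq h del: F.mor_Comp' U.mor_Comp')
  also have "(mor U (\<epsilon> ?d) \<boxtimes> mor U ?h) \<cdot> \<sigma>\<^sub>2\<^bsub>T\<^esub> ?U ?b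
    = iso_inv C (s2 ?d ?m) \<cdot> ext (?d \<otimes>\<^bsub>D\<^esub> ?m) (s2 ?d ?m \<cdot> (Ident C ?U \<boxtimes> \<phi> ?d))"
    by (subst tensor_\<sigma>2) (simp_all add: h ext_unit triangle_right del: F.mor_Comp' U.mor_Comp')
  also have "\<dots> \<cdot> mor U (mor F ?c) = iso_inv C (s2 ?d ?m) \<cdot> ext (?d \<otimes>\<^bsub>D\<^esub> ?m) (s2 ?d ?m \<cdot> ((Ident C ?U \<boxtimes> \<phi> ?d) \<cdot> ?c))"
    by simp
  also have "\<dots> = iso_inv C (s2 ?d ?m) \<cdot> ext (?d \<otimes>\<^bsub>D\<^esub> ?m) (mor U (coev M ?d) \<cdot> s0)"
    by (simp add: coev_\<phi>)
  also have "\<dots> = iso_inv C (s2 ?d ?m) \<cdot> (mor U (coev M ?d) \<cdot> ext \<one>\<^bsub>D\<^esub> s0)"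
    using mor_ext[of "coev M ?d" s0] by simp
  also have "?j \<cdot> \<dots> = (Ident C ?U \<boxtimes> mor (dual L) (\<eta> x)) \<cdot> (((Ident C ?U \<boxtimes> iso_inv C (\<phi> ?d)) \<cdot> coevU ?d) \<cdot> \<sigma>\<^sub>0\<^bsub>T\<^esub>)"
    by (simp add: \<sigma>0_eq)
  also have "\<dots> = (Ident C ?U \<boxtimes> mor (dual L) (\<eta> x)) \<cdot> (?c \<cdot> \<sigma>\<^sub>0\<^bsub>T\<^esub>)"
    by (simp only: \<phi>_inv_coevU F.ob_Obj assms)
  \<comment> \<open>Dinaturality of the coevaluation moves \<open>\<eta> x\<close> from the dual leg
    to the first leg.\<close>
  also have "\<dots> = (\<eta> x \<boxtimes> Ident C (ob (dual L) x)) \<cdot> (coev L x \<cdot> \<sigma>\<^sub>0\<^bsub>T\<^esub>)"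
    using CL.Comp_extend[OF CL.coev_dinaturality[of "\<eta> x", symmetric]] by simp
  finally show ?thesis .
qed

lemma left_antipode_S: "left_antipode C L T S"
proof -
  interpret bimonad C T by (rule bimonad_T)
  interpret op: category "opp C" by (rule CL.category_opp)
  interpret TF: category_functor C C "endo T" by unfold_locales
  \<comment> \<open>The source of the transformation \<open>S\<close> starts with the opposite of
    the endofunctor, which has the same data.\<close>
  have opT: "category_functor (opp C) (opp C) (endo T)"
    by unfold_locales (auto simp: Hom_iff)
  interpret TL: category_functor "opp C" C "endo T \<circ>\<^sub>F (dual L \<circ>\<^sub>F endo T)"
    by (intro category_functor_comp[OF category_functor_comp[OF opT]]) unfold_locales
  show ?thesis
  proof
    fix x assume [simp]: "x \<in> Obj C"
    show "ev L (ob (endo T) x) \<cdot> ((S (ob (endo T) x) \<cdot> mor (endo T) (mor (dual L) (\<mu>\<^bsub>T\<^esub> x)))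
              \<boxtimes> Ident C (ob (endo T) x)) \<cdot> \<sigma>\<^sub>2\<^bsub>T\<^esub> (ob (dual L) (ob (endo T) x)) x
      = \<sigma>\<^sub>0\<^bsub>T\<^esub> \<cdot> mor (endo T) (ev L x) \<cdot> mor (endo T) (mor (dual L) (\<iota>\<^bsub>T\<^esub> x) \<boxtimes> Ident C x)"
      using antipode_ev_S[of x] by simp
    show "(\<mu>\<^bsub>T\<^esub> x \<boxtimes> S x) \<cdot> \<sigma>\<^sub>2\<^bsub>T\<^esub> (ob (endo T) x) (ob (dual L) (ob (endo T) x))
        \<cdot> mor (endo T) (coev L (ob (endo T) x))
      = (\<iota>\<^bsub>T\<^esub> x \<boxtimes> Ident C (ob (dual L) x)) \<cdot> coev L x \<cdot> \<sigma>\<^sub>0\<^bsub>T\<^esub>"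
      using antipode_coev_S[of x] by simp
  next
    fix f a b assume "f \<in> Hom (opp C) a b"
    then show "S b \<cdot> mor (endo T \<circ>\<^sub>F dual L \<circ>\<^sub>F endo T) f = mor (dual L) f \<cdot> S a"
      using S_naturality[of f] by (auto simp: Hom_iff)
  qed (auto simp: Hom_iff)
qed

end

theorem theorem8:
  fixes C :: "('a, 'f) monoidal_category"
    and D :: "('b, 'g) monoidal_category"
    and L :: "('a, 'f) duality_data"
    and M :: "('b, 'g) duality_data"
    and F :: "('a, 'f, 'b, 'g) functor_data"
    and U :: "('b, 'g, 'a, 'f) functor_data"
    and \<eta> :: "'a \<Rightarrow> 'f"
    and \<epsilon> :: "'b \<Rightarrow> 'g"
    and s2 :: "'b \<Rightarrow> 'b \<Rightarrow> 'f"
    and s0 :: 'f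
  assumes "left_duality C L"
    and "left_duality D M"
    and "adjunction C D F U \<eta> \<epsilon>"
    and "strong_monoidal_functor D C U s2 s0"
  shows "left_antipode C L (adjunction_bimonad C D F U \<eta> \<epsilon> s2 s0)
           (adjunction_antipode C D L M F U \<eta> \<epsilon> s2 s0)"
proof -
  interpret duality_adjunction C D L M F U \<eta> \<epsilon> s2 s0
    by (intro duality_adjunction.intro assms)
  show ?thesis
    by (rule left_antipode_S)
qed

end
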